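(* Let $z,z'\in\mathbb C$. Upon the identification $\mathrm{Sym}_{\mathbb C}=\mathbb C[h_1,h_2,\dots]$, the Laguerre operator $\mathfrak D^{\mathsf L}:\mathrm{Sym}_{\mathbb C}\to\mathrm{Sym}_{\mathbb C}$ with parameters $z$ and $z'$ can be represented as the following second order differential operator in the variables $h_1,h_2,\dots$: $$ \begin{aligned} \mathfrak D^{\mathsf L}&=\sum_{n\ge1}\left(\sum_{k=0}^{n-1}(2n-1-2k)h_{2n-1-k}h_k\right)\frac{\partial^2}{\partial h_n^2}\\ &\quad+2\sum_{m>n\ge1}\left(\sum_{k=0}^{n-1}(m+n-1-2k)h_{m+n-1-k}h_k\right)\frac{\partial^2}{\partial h_m\partial h_n}\\ &\quad+\sum_{n=1}^\infty\big(-nh_n+(z+n-1)(z'+n-1)h_{n-1}\big)\frac{\partial}{\partial h_n}, \end{aligned} $$ with the understanding that $h_0=1$.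
   Context: $\mathbb Y$ is the set of all partitions, identified with Young diagrams; $|\nu|$ is the number of boxes of $\nu$. $\mathrm{Sym}$ is the algebra of symmetric functions over $\mathbb R$, $\mathrm{Sym}_{\mathbb C}=\mathrm{Sym}\otimes_{\mathbb R}\mathbb C$; $h_1,h_2,\dots$ are the complete homogeneous symmetric functions, which are algebraically independent generators, so $\mathrm{Sym}_{\mathbb C}=\mathbb C[h_1,h_2,\dots]$. $S_\nu$ ($\nu\in\mathbb Y$) are the Schur symmetric functions, which form a basis. For a box $\square=(i,j)$ (row $i$, column $j$) its content is $c(\square)=j-i$. $\nu^-$ denotes the set of corner boxes of $\nu$, i.e. boxes $\square\in\nu$ such that $\nu\setminus\square$ is again a Young diagram. The Laguerre operator with parameters $z,z'$ is the linear operator on $\mathrm{Sym}_{\mathbb C}$ defined by $$\mathfrak D^{\mathsf L}S_\nu=-|\nu|S_\nu+\sum_{\square\in\nu^-}(z+c(\square))(z'+c(\square))S_{\nu\setminus\square},\qquad \nu\in\mathbb Y.$$ *)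

theory Defs
  imports
    Complex_Main
    "HOL-Library.Poly_Mapping"
    "HOL-Library.Function_Algebras"
    "HOL-Combinatorics.Permutations"
    "Jordan_Normal_Form.Determinant"
begin

text \<open>
  Polynomials over the complex numbers in countably many commuting variables, indexed by
  \<open>0, 1, 2, \<dots>\<close>.  The ring structure is that of \<^theory>\<open>HOL-Library.Poly_Mapping\<close>.
\<close>

type_synonym cmpoly = "(nat \<Rightarrow>\<^sub>0 nat) \<Rightarrow>\<^sub>0 complex"

definition cpoly :: "complex \<Rightarrow> cmpoly" where
  "cpoly c = Poly_Mapping.single 0 c"

definition vpoly :: "nat \<Rightarrow> cmpoly" where
  "vpoly i = Poly_Mapping.single (Poly_Mapping.single i 1) 1"

definition mdeg :: "(nat \<Rightarrow>\<^sub>0 nat) \<Rightarrow> nat" where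
  "mdeg m = (\<Sum>i\<in>Poly_Mapping.keys m. Poly_Mapping.lookup m i)"

text \<open>The truncated subtraction is harmless: the coefficient vanishes if \<open>i\<close> does not occur in \<open>m\<close>.\<close>

definition pdiff :: "nat \<Rightarrow> cmpoly \<Rightarrow> cmpoly" where
  "pdiff i p = (\<Sum>m\<in>Poly_Mapping.keys p.
     Poly_Mapping.single (m - Poly_Mapping.single i 1)
       (of_nat (Poly_Mapping.lookup m i) * Poly_Mapping.lookup p m))"


text \<open>
  A symmetric function is a sequence \<open>f\<close> of bounded degree in which \<open>f N\<close> is a symmetric
  polynomial in \<open>x\<^sub>0, \<dots>, x\<^bsub>N-1\<^esub>\<close> and setting \<open>x\<^sub>N = 0\<close> in \<open>f (N + 1)\<close> gives \<open>f N\<close>: the inverse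
  limit of the rings of symmetric polynomials in the category of graded algebras.  Sums and
  products of such sequences are the pointwise ones of \<^theory>\<open>HOL-Library.Function_Algebras\<close>.
\<close>

definition sympoly :: "nat \<Rightarrow> cmpoly set" where
  "sympoly N = {p.
     (\<forall>m\<in>Poly_Mapping.keys p. Poly_Mapping.keys m \<subseteq> {..<N}) \<and>
     (\<forall>\<pi> m. \<pi> permutes {..<N} \<longrightarrow>
        Poly_Mapping.lookup p (Poly_Mapping.map_key \<pi> m) = Poly_Mapping.lookup p m)}"

definition SymC :: "(nat \<Rightarrow> cmpoly) set" where
  "SymC = {f.
     (\<forall>N. f N \<in> sympoly N) \<and>
     (\<forall>N m. Poly_Mapping.keys m \<subseteq> {..<N} \<longrightarrow>
        Poly_Mapping.lookup (f (Suc N)) m = Poly_Mapping.lookup (f N) m) \<and>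
     (\<exists>d. \<forall>N. \<forall>m\<in>Poly_Mapping.keys (f N). mdeg m \<le> d)}"

definition sf_scale :: "complex \<Rightarrow> (nat \<Rightarrow> cmpoly) \<Rightarrow> nat \<Rightarrow> cmpoly" where
  "sf_scale c f = (\<lambda>N. cpoly c * f N)"

definition complete_h :: "nat \<Rightarrow> nat \<Rightarrow> cmpoly" where
  "complete_h n = (\<lambda>N. \<Sum>m | Poly_Mapping.keys m \<subseteq> {..<N} \<and> mdeg m = n. Poly_Mapping.single m 1)"


text \<open>
  Rows and columns are numbered from \<open>0\<close>; the content \<open>j - i\<close> is not affected by the shift.
\<close>

definition young_diagram :: "(nat \<times> nat) set \<Rightarrow> bool" where
  "young_diagram \<nu> \<longleftrightarrow> finite \<nu> \<and>
     (\<forall>i j i' j'. (i, j) \<in> \<nu> \<longrightarrow> i' \<le> i \<longrightarrow> j' \<le> j \<longrightarrow> (i', j') \<in> \<nu>)"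

definition row_length :: "(nat \<times> nat) set \<Rightarrow> nat \<Rightarrow> nat" where
  "row_length \<nu> i = card {j. (i, j) \<in> \<nu>}"

definition corners :: "(nat \<times> nat) set \<Rightarrow> (nat \<times> nat) set" where
  "corners \<nu> = {b \<in> \<nu>. young_diagram (\<nu> - {b})}"

definition content :: "nat \<times> nat \<Rightarrow> complex" where
  "content b = of_nat (snd b) - of_nat (fst b)"

definition alternant :: "nat \<Rightarrow> (nat \<Rightarrow> nat) \<Rightarrow> cmpoly" where
  "alternant N \<alpha> = det (mat N N (\<lambda>(i, j). vpoly i ^ \<alpha> j))"

text \<open>
  In \<open>N\<close> variables the Schur polynomial is the quotient of alternants
  \<open>det (x\<^sub>i ^ (\<nu>\<^sub>j + N - 1 - j)) / det (x\<^sub>i ^ (N - 1 - j))\<close>, and \<open>0\<close> if \<open>\<nu>\<close> has more than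
  \<open>N\<close> nonempty rows.
\<close>

definition schur :: "(nat \<times> nat) set \<Rightarrow> nat \<Rightarrow> cmpoly" where
  "schur \<nu> = (\<lambda>N.
     if \<forall>i\<ge>N. row_length \<nu> i = 0
     then (THE s. s * alternant N (\<lambda>j. N - 1 - j) = alternant N (\<lambda>j. row_length \<nu> j + (N - 1 - j)))
     else 0)"


definition is_laguerre_operator ::
    "complex \<Rightarrow> complex \<Rightarrow> ((nat \<Rightarrow> cmpoly) \<Rightarrow> nat \<Rightarrow> cmpoly) \<Rightarrow> bool" where
  "is_laguerre_operator z z' D \<longleftrightarrow>
     (\<forall>f\<in>SymC. D f \<in> SymC) \<and>
     (\<forall>f\<in>SymC. \<forall>g\<in>SymC. D (f + g) = D f + D g) \<and>
     (\<forall>c. \<forall>f\<in>SymC. D (sf_scale c f) = sf_scale c (D f)) \<and>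
     (\<forall>\<nu>. young_diagram \<nu> \<longrightarrow>
        D (schur \<nu>) = sf_scale (- of_nat (card \<nu>)) (schur \<nu>) +
          (\<Sum>b\<in>corners \<nu>. sf_scale ((z + content b) * (z' + content b)) (schur (\<nu> - {b}))))"


text \<open>
  In \<open>\<complex>[h\<^sub>1, h\<^sub>2, \<dots>]\<close> the variable with index \<open>i\<close> plays the role of \<open>h\<^bsub>i+1\<^esub>\<close>, and \<open>h\<^sub>0 = 1\<close>.
  The map \<open>from_h\<close> is the algebra homomorphism to the symmetric functions with \<open>h\<^sub>n \<mapsto> h\<^sub>n\<close>,
  i.e. the identification of the two algebras.
\<close>

definition hvar :: "nat \<Rightarrow> cmpoly" where
  "hvar n = (if n = 0 then 1 else vpoly (n - 1))"

definition dh :: "nat \<Rightarrow> cmpoly \<Rightarrow> cmpoly" where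
  "dh n p = pdiff (n - 1) p"

definition from_h :: "cmpoly \<Rightarrow> nat \<Rightarrow> cmpoly" where
  "from_h p = (\<Sum>m\<in>Poly_Mapping.keys p.
     sf_scale (Poly_Mapping.lookup p m)
       (\<Prod>i\<in>Poly_Mapping.keys m. complete_h (Suc i) ^ Poly_Mapping.lookup m i))"

text \<open>
  The infinite sums have only finitely many nonzero terms when applied to a polynomial, so they
  are written with \<^const>\<open>Sum_any\<close>.
\<close>

definition laguerre_diffop :: "complex \<Rightarrow> complex \<Rightarrow> cmpoly \<Rightarrow> cmpoly" where
  "laguerre_diffop z z' p =
     Sum_any (\<lambda>n.
       (\<Sum>k<n. of_nat (2 * n - 1 - 2 * k) * hvar (2 * n - 1 - k) * hvar k) * dh n (dh n p)
       when 1 \<le> n)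
   + 2 * Sum_any (\<lambda>(m, n).
       (\<Sum>k<n. of_nat (m + n - 1 - 2 * k) * hvar (m + n - 1 - k) * hvar k) * dh m (dh n p)
       when 1 \<le> n \<and> n < m)
   + Sum_any (\<lambda>n.
       (- of_nat n * hvar n
        + cpoly ((z + of_nat n - 1) * (z' + of_nat n - 1)) * hvar (n - 1)) * dh n p
       when 1 \<le> n)"

end

theory Submission
  imports Defs "HOL-Computational_Algebra.Formal_Power_Series"
begin

text \<open>
  Both sides of the claim are linear in \<open>p\<close>, so it suffices to compare them on polynomials in
  \<open>h\<^sub>1, h\<^sub>2, \<dots>\<close> that span.  The Jacobi--Trudi determinants
  \<open>J(m) = det (h(m\<^sub>i + j))\<close>, with \<open>0 \<le> i, j < l\<close> and arbitrary integers \<open>m\<^sub>0, \<dots>, m\<^bsub>l-1\<^esub>\<close>,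
  are used for this; here \<open>h(a) = h\<^sub>a\<close>, and \<open>h\<^sub>a = 0\<close> for \<open>a < 0\<close>.

  The differential operator is computed on \<open>J(m)\<close> for every \<open>m\<close>
  (\<open>laguerre_diffop_jacobi_trudi\<close>):
  \<open>L J(m) = - \<Sum>\<^sub>i (m\<^sub>i + i) J(m) + \<Sum>\<^sub>i (z + m\<^sub>i - 1) (z' + m\<^sub>i - 1) J(m - e\<^sub>i)\<close>.
  Expand \<open>J(m)\<close> over permutations \<open>\<tau>\<close> into products of the \<open>h(m\<^sub>i + \<tau>\<^sub>i)\<close>.  On a product, \<open>L\<close> gives
  first-order terms with coefficient \<open>(z + m\<^sub>i + \<tau>\<^sub>i - 1) (z' + m\<^sub>i + \<tau>\<^sub>i - 1)\<close>, and one second-order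
  term for every ordered pair of factors.  After alternating summation the first-order terms exceed the
  asserted ones only by terms with the weights \<open>2 m\<^sub>i \<tau>\<^sub>i\<close>: a remaining weight that is a function \<open>f(\<tau>\<^sub>i)\<close> with
  \<open>f(0) = 0\<close> produces determinants with two equal columns (\<open>sum_lowered_prod\<close>).  The second-order terms
  cancel this excess.  Indeed, the coefficients \<open>\<Gamma>\<^bsub>a,b\<^esub>\<close> of the pairs satisfy
  \<open>\<Gamma>\<^bsub>a,b+1\<^esub> - \<Gamma>\<^bsub>a+1,b\<^esub> = (a - b) h\<^sub>a h\<^sub>b\<close>, so that dividing the Vandermonde product
  \<open>V(u) = \<Sum>\<^sub>\<tau> sgn \<tau> u\<^sup>\<tau>\<close> by \<open>u\<^sub>i - u\<^sub>j\<close> turns the pair terms into terms with \<open>h\<^sub>a h\<^sub>b\<close>; the quotients add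
  up to \<open>\<Sum>\<^bsub>j\<noteq>i\<^esub> V / (u\<^sub>i - u\<^sub>j) = \<partial>V / \<partial>u\<^sub>i\<close> (\<open>sum_pair_functional_vandermonde\<close>).

  If \<open>m\<^sub>i = \<nu>\<^sub>i - i\<close> for a Young diagram \<open>\<nu>\<close> with at most \<open>l\<close> rows, then \<open>J(m)\<close> is the Schur function of
  \<open>\<nu>\<close> (the Jacobi--Trudi identity, \<open>schur_eq_jacobi_trudi\<close>), \<open>m\<^sub>i - 1\<close> is the content of the last box
  of row \<open>i\<close>, and \<open>J(m - e\<^sub>i)\<close> is the Schur function of \<open>\<nu>\<close> without that box if the box is a corner,
  and \<open>0\<close> otherwise.  So the two operators agree on Schur functions.  Sorting the rows shows that every
  \<open>J(m)\<close> is \<open>0\<close> or, up to sign, a Schur function, and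
  a product of \<open>h(a\<^sub>i)\<close>, \<open>i < l\<close>, with \<open>a\<^sub>i \<ge> 0\<close> is \<open>J(m)\<close> with \<open>m\<^sub>i = a\<^sub>i - i\<close> minus products with smaller \<open>\<Sum>\<^sub>i i a\<^sub>i\<close>, so
  the determinants span (\<open>intertwined_prod\<close>).
\<close>

section \<open>Linear maps on polynomials\<close>

text \<open>
  The linear map that sends the monomial with exponent vector \<open>m\<close> to \<open>\<phi> m\<close>.  It is a ring
  homomorphism if \<open>\<phi>\<close> is multiplicative.
\<close>

definition lin_ext :: "((nat \<Rightarrow>\<^sub>0 nat) \<Rightarrow> cmpoly) \<Rightarrow> cmpoly \<Rightarrow> cmpoly" where
  "lin_ext \<phi> p = (\<Sum>m\<in>Poly_Mapping.keys p. cpoly (Poly_Mapping.lookup p m) * \<phi> m)"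

lemma cpoly_0 [simp]: "cpoly 0 = 0"
  and cpoly_1 [simp]: "cpoly 1 = 1"
  and cpoly_add: "cpoly (a + b) = cpoly a + cpoly b"
  and cpoly_mult: "cpoly (a * b) = cpoly a * cpoly b"
  and cpoly_minus: "cpoly (- a) = - cpoly a"
  and cpoly_of_nat: "cpoly (of_nat n) = of_nat n"
  and cpoly_of_int: "cpoly (of_int k) = of_int k"
  by (simp_all add: cpoly_def single_add mult_single single_uminus)

lemma lookup_cpoly_mult: "Poly_Mapping.lookup (cpoly c * p) m = c * Poly_Mapping.lookup p m"
  unfolding cpoly_def mult_map_scale_conv_mult[symmetric]
  by (simp add: Poly_Mapping.map.rep_eq when_def)

lemma keys_cpoly_mult: "Poly_Mapping.keys (cpoly c * p) \<subseteq> Poly_Mapping.keys p"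
  by (auto simp: in_keys_iff lookup_cpoly_mult)

lemma lin_ext_superset:
  assumes "finite A" "Poly_Mapping.keys p \<subseteq> A"
  shows "lin_ext \<phi> p = (\<Sum>m\<in>A. cpoly (Poly_Mapping.lookup p m) * \<phi> m)"
  unfolding lin_ext_def using assms
  by (intro sum.mono_neutral_left) (auto simp: in_keys_iff)

lemma lin_ext_0 [simp]: "lin_ext \<phi> 0 = 0"
  by (simp add: lin_ext_def)

lemma lin_ext_single [simp]: "lin_ext \<phi> (Poly_Mapping.single m c) = cpoly c * \<phi> m"
  by (simp add: lin_ext_def)

lemma lin_ext_add: "lin_ext \<phi> (p + q) = lin_ext \<phi> p + lin_ext \<phi> q"
proof -
  let ?A = "Poly_Mapping.keys p \<union> Poly_Mapping.keys q"
  have "lin_ext \<phi> r = (\<Sum>m\<in>?A. cpoly (Poly_Mapping.lookup r m) * \<phi> m)"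
    if "r \<in> {p, q, p + q}" for r
    using that Poly_Mapping.keys_add[of p q] by (intro lin_ext_superset) auto
  then show ?thesis
    by (simp add: lookup_add cpoly_add distrib_right sum.distrib)
qed

lemma lin_ext_scale: "lin_ext \<phi> (cpoly c * p) = cpoly c * lin_ext \<phi> p"
proof -
  have "lin_ext \<phi> (cpoly c * p) = (\<Sum>m\<in>Poly_Mapping.keys p. cpoly (Poly_Mapping.lookup (cpoly c * p) m) * \<phi> m)"
    by (intro lin_ext_superset keys_cpoly_mult) auto
  also have "\<dots> = cpoly c * lin_ext \<phi> p"
    by (simp add: lin_ext_def lookup_cpoly_mult cpoly_mult sum_distrib_left mult.assoc)
  finally show ?thesis .
qed

lemma lin_ext_minus: "lin_ext \<phi> (- p) = - lin_ext \<phi> p"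
  using lin_ext_scale[of \<phi> "-1" p] by (simp add: cpoly_minus)

lemma lin_ext_diff: "lin_ext \<phi> (p - q) = lin_ext \<phi> p - lin_ext \<phi> q"
  using lin_ext_add[of \<phi> p "- q"] by (simp add: lin_ext_minus)

lemma lin_ext_sum: "lin_ext \<phi> (\<Sum>i\<in>A. f i) = (\<Sum>i\<in>A. lin_ext \<phi> (f i))"
  by (induction A rule: infinite_finite_induct) (auto simp: lin_ext_add)

lemma lin_ext_monomials: "lin_ext (\<lambda>m. Poly_Mapping.single m 1) p = p"
  by (rule poly_mapping_eqI)
     (simp add: lin_ext_def lookup_sum lookup_cpoly_mult lookup_single when_def if_distrib in_keys_iff
        sum.delta' cong: if_cong)

lemma cmpoly_induct [case_names monomial add]:
  fixes p :: cmpoly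
  assumes monomial: "\<And>m c. P (Poly_Mapping.single m c)"
    and add: "\<And>p q. P p \<Longrightarrow> P q \<Longrightarrow> P (p + q)"
  shows "P p"
proof -
  have zero: "P 0" using monomial[of 0 0] by simp
  have "P (\<Sum>m\<in>A. cpoly (f m) * Poly_Mapping.single m 1)" if "finite A" for A f
    using that by induction (auto simp: zero cpoly_def mult_single intro: monomial add)
  from this[of "Poly_Mapping.keys p" "Poly_Mapping.lookup p"] show ?thesis
    using lin_ext_monomials[of p] by (simp add: lin_ext_def)
qed

lemma lin_ext_mult:
  assumes "\<And>m m'. \<phi> (m + m') = \<phi> m * \<phi> m'"
  shows "lin_ext \<phi> (p * q) = lin_ext \<phi> p * lin_ext \<phi> q"
proof (induction p rule: cmpoly_induct)
  case (monomial m c)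
  show ?case
    by (induction q rule: cmpoly_induct)
       (simp_all add: mult_single assms cpoly_mult distrib_left distrib_right lin_ext_add mult_ac)
qed (simp add: distrib_right lin_ext_add)

lemma lin_ext_ring_hom:
  assumes "\<phi> 0 = 1" "\<And>m m'. \<phi> (m + m') = \<phi> m * \<phi> m'"
  shows "comm_ring_hom (lin_ext \<phi>)"
proof
  show "lin_ext \<phi> 1 = 1"
    using lin_ext_single[of \<phi> 0 1] assms(1) by simp
qed (auto simp: lin_ext_add lin_ext_mult[OF assms(2)])

lemma lookup_monomial_single: "Poly_Mapping.lookup (Poly_Mapping.single i (k::nat)) j = (if i = j then k else 0)"
  by (simp add: lookup_single when_def)

lemma vpoly_power: "vpoly i ^ k = Poly_Mapping.single (Poly_Mapping.single i k) 1"
  by (induction k) (simp_all add: vpoly_def mult_single flip: single_add)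

lemma prod_single_1:
  "(\<Prod>i\<in>A. Poly_Mapping.single (f i) (1::complex)) = Poly_Mapping.single (\<Sum>i\<in>A. f i :: nat \<Rightarrow>\<^sub>0 nat) 1"
  by (induction A rule: infinite_finite_induct) (auto simp: mult_single)

lemma monomial_as_prod: "Poly_Mapping.single m 1 = (\<Prod>i\<in>Poly_Mapping.keys m. vpoly i ^ Poly_Mapping.lookup m i)"
proof -
  have "m = (\<Sum>i\<in>Poly_Mapping.keys m. Poly_Mapping.single i (Poly_Mapping.lookup m i))"
    by (rule poly_mapping_eqI)
       (simp add: lookup_sum lookup_monomial_single in_keys_iff cong: if_cong)
  then show ?thesis by (simp add: vpoly_power prod_single_1)
qed

section \<open>Partial derivatives\<close>

lemma pdiff_eq_lin_ext:
  "pdiff i = lin_ext (\<lambda>m. Poly_Mapping.single (m - Poly_Mapping.single i 1) (of_nat (Poly_Mapping.lookup m i)))"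
  by (rule ext) (simp add: pdiff_def lin_ext_def cpoly_def mult_single mult.commute)

lemma pdiff_0 [simp]: "pdiff i 0 = 0"
  and pdiff_add: "pdiff i (p + q) = pdiff i p + pdiff i q"
  and pdiff_minus: "pdiff i (- p) = - pdiff i p"
  and pdiff_diff: "pdiff i (p - q) = pdiff i p - pdiff i q"
  and pdiff_scale: "pdiff i (cpoly c * p) = cpoly c * pdiff i p"
  and pdiff_sum: "pdiff i (\<Sum>a\<in>A. f a) = (\<Sum>a\<in>A. pdiff i (f a))"
  by (simp_all add: pdiff_eq_lin_ext lin_ext_add lin_ext_minus lin_ext_diff lin_ext_scale lin_ext_sum)

lemma pdiff_monomial:
  "pdiff i (Poly_Mapping.single m c)
     = Poly_Mapping.single (m - Poly_Mapping.single i 1) (of_nat (Poly_Mapping.lookup m i) * c)"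
  by (simp add: pdiff_eq_lin_ext cpoly_def mult_single mult.commute)

lemma pdiff_1 [simp]: "pdiff i 1 = 0"
  using pdiff_monomial[of i 0 1] by simp

lemma pdiff_vpoly: "pdiff i (vpoly j) = (if i = j then 1 else 0)"
  by (simp add: vpoly_def pdiff_monomial lookup_monomial_single)

lemma monomial_minus_add:
  fixes m m' :: "nat \<Rightarrow>\<^sub>0 nat"
  assumes "Poly_Mapping.lookup m i > 0"
  shows "m - Poly_Mapping.single i 1 + m' = m + m' - Poly_Mapping.single i 1"
  using assms
  by (intro poly_mapping_eqI) (auto simp: lookup_add lookup_minus lookup_monomial_single)

lemma pdiff_mult: "pdiff i (p * q) = pdiff i p * q + p * pdiff i q"
proof (induction p rule: cmpoly_induct)
  case (monomial m c)
  show ?case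
  proof (induction q rule: cmpoly_induct)
    case (monomial m' d)
    have left: "Poly_Mapping.single (m - Poly_Mapping.single i 1 + m') (of_nat (Poly_Mapping.lookup m i) * c * d)
        = Poly_Mapping.single (m + m' - Poly_Mapping.single i 1) (of_nat (Poly_Mapping.lookup m i) * c * d)"
      by (cases "Poly_Mapping.lookup m i = 0") (simp_all add: monomial_minus_add[unfolded One_nat_def])
    have "Poly_Mapping.single (m + (m' - Poly_Mapping.single i 1)) (of_nat (Poly_Mapping.lookup m' i) * c * d)
        = Poly_Mapping.single (m + m' - Poly_Mapping.single i 1) (of_nat (Poly_Mapping.lookup m' i) * c * d)"
      using monomial_minus_add[of m' i m]
      by (cases "Poly_Mapping.lookup m' i = 0") (simp_all add: add.commute)
    with left show ?case
      by (simp add: pdiff_monomial mult_single lookup_add algebra_simps flip: single_add)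
  qed (simp add: pdiff_add algebra_simps)
qed (simp add: pdiff_add algebra_simps)

lemma pdiff_commute: "pdiff i (pdiff j p) = pdiff j (pdiff i p)"
proof (induction p rule: cmpoly_induct)
  case (monomial m c)
  have "m - Poly_Mapping.single i 1 - Poly_Mapping.single j 1
      = m - Poly_Mapping.single j 1 - Poly_Mapping.single i 1"
    by (intro poly_mapping_eqI) (auto simp: lookup_minus)
  then show ?case
    by (cases "i = j") (simp_all add: pdiff_monomial lookup_minus lookup_monomial_single mult_ac)
qed (simp add: pdiff_add)

lemma pdiff_prod:
  assumes "finite A"
  shows "pdiff i (\<Prod>a\<in>A. f a) = (\<Sum>a\<in>A. pdiff i (f a) * (\<Prod>b\<in>A - {a}. f b))"
  using assms
proof induction
  case (insert x A)
  have "(\<Prod>b\<in>insert x A - {a}. f b) = f x * (\<Prod>b\<in>A - {a}. f b)" if "a \<in> A" for a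
  proof -
    have "insert x A - {a} = insert x (A - {a})" using insert.hyps that by auto
    then show ?thesis using insert.hyps by simp
  qed
  then show ?case
    using insert by (simp add: pdiff_mult sum_distrib_left mult_ac)
qed simp

section \<open>Polynomials in the complete homogeneous symmetric functions\<close>

lemma sum_fun_apply: "(\<Sum>i\<in>A. f i) x = (\<Sum>i\<in>A. f i x)"
  for f :: "'i \<Rightarrow> 'x \<Rightarrow> 'y::comm_monoid_add"
  by (induction A rule: infinite_finite_induct) auto

lemma power_fun_apply: "(f ^ n) x = f x ^ n"
  for f :: "'x \<Rightarrow> 'y::comm_semiring_1"
  by (induction n) auto

lemma prod_fun_apply: "(\<Prod>i\<in>A. f i) x = (\<Prod>i\<in>A. f i x)"
  for f :: "'i \<Rightarrow> 'x \<Rightarrow> 'y::comm_semiring_1"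
  by (induction A rule: infinite_finite_induct) auto

text \<open>
  The value of a monomial in \<open>h\<^sub>1, h\<^sub>2, \<dots>\<close> in \<open>N\<close> variables; the exponent of \<open>h\<^bsub>i+1\<^esub>\<close> is the
  entry of \<open>m\<close> at \<open>i\<close>.
\<close>

definition h_monomial :: "nat \<Rightarrow> (nat \<Rightarrow>\<^sub>0 nat) \<Rightarrow> cmpoly" where
  "h_monomial N m = (\<Prod>i\<in>Poly_Mapping.keys m. complete_h (Suc i) N ^ Poly_Mapping.lookup m i)"

lemma prod_lookup_superset:
  fixes g :: "nat \<Rightarrow> 'a::comm_semiring_1"
  assumes "finite A" "Poly_Mapping.keys m \<subseteq> A"
  shows "(\<Prod>i\<in>Poly_Mapping.keys m. g i ^ Poly_Mapping.lookup m i) = (\<Prod>i\<in>A. g i ^ Poly_Mapping.lookup m i)"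
  using assms by (intro prod.mono_neutral_left) (auto simp: in_keys_iff)

lemma prod_lookup_add:
  fixes g :: "nat \<Rightarrow> 'a::comm_semiring_1"
  shows "(\<Prod>i\<in>Poly_Mapping.keys (m + m'). g i ^ Poly_Mapping.lookup (m + m') i)
       = (\<Prod>i\<in>Poly_Mapping.keys m. g i ^ Poly_Mapping.lookup m i)
         * (\<Prod>i\<in>Poly_Mapping.keys m'. g i ^ Poly_Mapping.lookup m' i)"
proof -
  let ?A = "Poly_Mapping.keys m \<union> Poly_Mapping.keys m'"
  have "(\<Prod>i\<in>Poly_Mapping.keys r. g i ^ Poly_Mapping.lookup r i) = (\<Prod>i\<in>?A. g i ^ Poly_Mapping.lookup r i)"
    if "r \<in> {m, m', m + m'}" for r
    using that Poly_Mapping.keys_add[of m m'] by (intro prod_lookup_superset) auto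
  note eq = this
  show ?thesis
    unfolding eq[of m, simplified] eq[of m', simplified] eq[of "m + m'", simplified]
    by (simp add: lookup_add power_add prod.distrib)
qed

lemma h_monomial_0: "h_monomial N 0 = 1"
  and h_monomial_add: "h_monomial N (m + m') = h_monomial N m * h_monomial N m'"
  by (simp_all add: h_monomial_def prod_lookup_add)

lemma from_h_eq_lin_ext: "from_h p N = lin_ext (h_monomial N) p"
  by (simp add: from_h_def lin_ext_def sum_fun_apply sf_scale_def h_monomial_def
      power_fun_apply prod_fun_apply)

lemma from_h_add: "from_h (p + q) = from_h p + from_h q"
  and from_h_scale: "from_h (cpoly c * p) = sf_scale c (from_h p)"
  and from_h_mult: "from_h (p * q) = from_h p * from_h q"
  and from_h_1 [simp]: "from_h 1 = 1"
  using lin_ext_single[of "h_monomial _" 0 1]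
  by (auto simp: fun_eq_iff sf_scale_def from_h_eq_lin_ext lin_ext_add lin_ext_scale
      lin_ext_mult[of "h_monomial _", OF h_monomial_add] h_monomial_0)

lemma from_h_0 [simp]: "from_h 0 = 0"
  by (simp add: fun_eq_iff from_h_eq_lin_ext)

lemma from_h_sum: "from_h (\<Sum>a\<in>A. f a) = (\<Sum>a\<in>A. from_h (f a))"
  by (induction A rule: infinite_finite_induct) (simp_all add: from_h_add)

lemma from_h_ring_hom: "comm_ring_hom (\<lambda>p. from_h p N)"
  unfolding from_h_eq_lin_ext by (intro lin_ext_ring_hom h_monomial_0 h_monomial_add)

lemma finite_bounded_monomials:
  "finite {m. Poly_Mapping.keys m \<subseteq> {..<N} \<and> mdeg m = n}"
proof -
  have "Poly_Mapping.lookup m ` {..<N} \<subseteq> {..n}"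
    if "Poly_Mapping.keys m \<subseteq> {..<N}" "mdeg m = n" for m
  proof (intro image_subsetI)
    fix i
    show "Poly_Mapping.lookup m i \<in> {..n}"
    proof (cases "i \<in> Poly_Mapping.keys m")
      case True
      then have "Poly_Mapping.lookup m i \<le> mdeg m"
        unfolding mdeg_def by (intro member_le_sum) auto
      with that show ?thesis by simp
    qed (simp add: in_keys_iff)
  qed
  then have "Poly_Mapping.lookup ` {m. Poly_Mapping.keys m \<subseteq> {..<N} \<and> mdeg m = n}
      \<subseteq> {f. \<forall>i. (i \<in> {..<N} \<longrightarrow> f i \<in> {..n}) \<and> (i \<notin> {..<N} \<longrightarrow> f i = 0)}"
    by (auto simp: image_subset_iff subset_iff in_keys_iff)
  then have "finite (Poly_Mapping.lookup ` {m. Poly_Mapping.keys m \<subseteq> {..<N} \<and> mdeg m = n})"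
    by (rule finite_subset) (intro finite_set_of_finite_funs; simp)
  then show ?thesis
    by (rule finite_imageD) (simp add: inj_on_def)
qed

lemma lookup_complete_h:
  "Poly_Mapping.lookup (complete_h n N) m = (if Poly_Mapping.keys m \<subseteq> {..<N} \<and> mdeg m = n then 1 else 0)"
  using finite_bounded_monomials[of N n]
  by (auto simp: complete_h_def lookup_sum lookup_single when_def if_distrib cong: if_cong)

lemma mdeg_0 [simp]: "mdeg 0 = 0"
  by (simp add: mdeg_def)

lemma mdeg_superset:
  assumes "finite A" "Poly_Mapping.keys m \<subseteq> A"
  shows "mdeg m = (\<Sum>i\<in>A. Poly_Mapping.lookup m i)"
  unfolding mdeg_def using assms by (intro sum.mono_neutral_left) (auto simp: in_keys_iff)

lemma mdeg_add: "mdeg (m + m') = mdeg m + mdeg m'"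
proof -
  let ?A = "Poly_Mapping.keys m \<union> Poly_Mapping.keys m'"
  have "mdeg r = (\<Sum>i\<in>?A. Poly_Mapping.lookup r i)" if "r \<in> {m, m', m + m'}" for r
    using that Poly_Mapping.keys_add[of m m'] by (intro mdeg_superset) auto
  then show ?thesis
    by (simp add: lookup_add sum.distrib)
qed

lemma mdeg_single [simp]: "mdeg (Poly_Mapping.single i k) = k"
  by (simp add: mdeg_def)

lemma mdeg_eq_0_iff: "mdeg m = 0 \<longleftrightarrow> m = 0"
  by (auto simp: mdeg_def in_keys_iff) (metis not_in_keys_iff_lookup_eq_zero poly_mapping_eqI lookup_zero)

lemma complete_h_0 [simp]: "complete_h 0 N = 1"
  by (rule poly_mapping_eqI) (auto simp: lookup_complete_h mdeg_eq_0_iff lookup_one when_def)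

lemma from_h_hvar: "from_h (hvar n) = complete_h n"
proof (cases n)
  case (Suc k)
  then show ?thesis
    by (simp add: fun_eq_iff hvar_def vpoly_def from_h_eq_lin_ext h_monomial_def)
qed (auto simp: hvar_def fun_eq_iff)

section \<open>The differential operator on products\<close>

text \<open>
  The variable \<open>h\<^sub>a\<close> for an integer \<open>a\<close>, with \<open>h\<^sub>0 = 1\<close> and \<open>h\<^sub>a = 0\<close> for \<open>a < 0\<close>.
\<close>

definition h_int :: "int \<Rightarrow> cmpoly" where
  "h_int a = (if a < 0 then 0 else hvar (nat a))"

text \<open>
  The coefficient of \<open>\<partial>\<^sup>2 / \<partial>h\<^sub>m \<partial>h\<^sub>n\<close>, for each ordered pair \<open>(m, n)\<close>.  It vanishes if an index is \<open>0\<close>,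
  so that no case distinction is needed for factors \<open>h\<^sub>0 = 1\<close>.
\<close>

definition pair_coeff :: "nat \<Rightarrow> nat \<Rightarrow> cmpoly" where
  "pair_coeff m n = (\<Sum>k<min m n. of_nat (m + n - 1 - 2 * k) * hvar (m + n - 1 - k) * hvar k)"

lemma pair_coeff_commute: "pair_coeff m n = pair_coeff n m"
  by (simp add: pair_coeff_def add.commute min.commute)

lemma pair_coeff_0 [simp]: "pair_coeff 0 n = 0" "pair_coeff m 0 = 0"
  by (simp_all add: pair_coeff_def)

lemma pair_coeff_shift_aux:
  assumes "n \<le> m"
  shows "pair_coeff m (Suc n) - pair_coeff (Suc m) n = of_int (int m - int n) * hvar m * hvar n"
proof (cases "m = n")
  case True
  then show ?thesis by (simp add: pair_coeff_commute[of "Suc n"])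
next
  case False
  with assms have "min m (Suc n) = Suc n" "min (Suc m) n = n" "m + n - 2 * n = m - n"
    by auto
  then show ?thesis
    using assms by (simp add: pair_coeff_def of_nat_diff)
qed

lemma pair_coeff_shift:
  "pair_coeff m (Suc n) - pair_coeff (Suc m) n = of_int (int m - int n) * hvar m * hvar n"
proof (cases "n \<le> m")
  case False
  then have "pair_coeff n (Suc m) - pair_coeff (Suc n) m = of_int (int n - int m) * hvar n * hvar m"
    by (intro pair_coeff_shift_aux) simp
  then have "- (pair_coeff n (Suc m) - pair_coeff (Suc n) m) = - (of_int (int n - int m) * hvar n * hvar m)"
    by simp
  then show ?thesis
    by (simp add: pair_coeff_commute[of "Suc _"] algebra_simps)
qed (rule pair_coeff_shift_aux)

text \<open>
  This recurrence is the only property of the second-order coefficients that is needed, besides their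
  symmetry.  By means of \<open>nat\<close> it extends to negative indices, where both sides vanish.
\<close>

lemma pair_coeff_int_shift:
  "pair_coeff (nat a) (nat (b + 1)) - pair_coeff (nat (a + 1)) (nat b) = of_int (a - b) * h_int a * h_int b"
proof -
  consider "a < 0" | "b < 0" | "a \<ge> 0" "b \<ge> 0" by linarith
  then show ?thesis
  proof cases
    case 3
    then show ?thesis
      using pair_coeff_shift[of "nat a" "nat b"] by (simp add: h_int_def nat_add_distrib)
  qed (simp_all add: h_int_def)
qed

lemma dh_add: "dh n (p + q) = dh n p + dh n q"
  and dh_scale: "dh n (cpoly c * p) = cpoly c * dh n p"
  and dh_0 [simp]: "dh n 0 = 0"
  and dh_commute: "dh m (dh n p) = dh n (dh m p)"
  by (simp_all add: dh_def pdiff_add pdiff_scale pdiff_commute)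

lemma dh_h_int: "n \<ge> 1 \<Longrightarrow> dh n (h_int a) = (if a = int n then 1 else 0)"
  by (auto simp: dh_def h_int_def hvar_def pdiff_vpoly)

lemma dh_prod: "finite A \<Longrightarrow> dh n (\<Prod>a\<in>A. f a) = (\<Sum>a\<in>A. dh n (f a) * (\<Prod>b\<in>A - {a}. f b))"
  by (simp add: dh_def pdiff_prod)

lemma dh_eventually_0: "\<exists>M. \<forall>n>M. dh n p = 0"
proof (induction p rule: cmpoly_induct)
  case (monomial m c)
  obtain M where "\<forall>i\<in>Poly_Mapping.keys m. i < M"
    using finite_nat_set_iff_bounded[of "Poly_Mapping.keys m"] by auto
  then have "\<forall>n>M. Poly_Mapping.lookup m (n - 1) = 0"
    by (metis One_nat_def Suc_pred in_keys_iff less_Suc_eq_le less_zeroE linorder_not_less neq0_conv)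
  then have "\<forall>n>M. dh n (Poly_Mapping.single m c) = 0" by (simp add: dh_def pdiff_monomial)
  then show ?case by blast
next
  case (add p q)
  then obtain M M' where "\<forall>n>M. dh n p = 0" "\<forall>n>M'. dh n q = 0" by blast
  then have "\<forall>n>max M M'. dh n (p + q) = 0" by (simp add: dh_add)
  then show ?case by blast
qed

text \<open>
  The coefficient of \<open>\<partial> / \<partial>h\<^sub>n\<close>.
\<close>

definition first_order_coeff :: "complex \<Rightarrow> complex \<Rightarrow> nat \<Rightarrow> cmpoly" where
  "first_order_coeff z z' n = - of_nat n * hvar n
        + cpoly ((z + of_nat n - 1) * (z' + of_nat n - 1)) * hvar (n - 1)"

lemma sum_symmetric_square:
  fixes f :: "nat \<Rightarrow> nat \<Rightarrow> 'a::comm_semiring_1"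
  assumes "\<And>m n. f m n = f n m" "finite A"
  shows "(\<Sum>m\<in>A. \<Sum>n\<in>A. f m n) = (\<Sum>n\<in>A. f n n) + 2 * (\<Sum>(m, n)\<in>A \<times> A. if n < m then f m n else 0)"
proof -
  have "(\<Sum>m\<in>A. \<Sum>n\<in>A. f m n) = (\<Sum>m\<in>A. \<Sum>n\<in>A. (if m = n then f n n else 0)
      + (if n < m then f m n else 0) + (if m < n then f n m else 0))"
    using assms(1) by (intro sum.cong) auto
  also have "\<dots> = (\<Sum>n\<in>A. f n n) + (\<Sum>m\<in>A. \<Sum>n\<in>A. if n < m then f m n else 0)
       + (\<Sum>m\<in>A. \<Sum>n\<in>A. if m < n then f n m else 0)"
    using assms(2) by (simp add: sum.distrib)
  also have "(\<Sum>m\<in>A. \<Sum>n\<in>A. if m < n then f n m else 0) = (\<Sum>m\<in>A. \<Sum>n\<in>A. if n < m then f m n else 0)"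
    by (rule sum.swap)
  finally show ?thesis
    by (simp add: sum.cartesian_product mult_2 add.assoc)
qed

text \<open>
  The formal infinite sums reduce to finite ones as soon as \<open>M\<close> bounds the indices of the variables that
  occur, and the terms with \<open>m > n\<close>, taken twice, combine with the diagonal ones into a sum over all
  ordered pairs.
\<close>

lemma laguerre_diffop_finite:
  assumes vanish: "\<forall>n>M. dh n p = 0"
  shows "laguerre_diffop z z' p
    = (\<Sum>m\<in>{1..M}. \<Sum>n\<in>{1..M}. pair_coeff m n * dh m (dh n p)) + (\<Sum>n\<in>{1..M}. first_order_coeff z z' n * dh n p)"
proof -
  have vanish2: "dh m (dh n p) = 0" if "m > M \<or> n > M" for m n
    using that vanish dh_commute[of m n p] by auto
  have diag: "(\<Sum>k<n. of_nat (2 * n - 1 - 2 * k) * hvar (2 * n - 1 - k) * hvar k) = pair_coeff n n" for n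
    unfolding pair_coeff_def mult_2[of n] by (simp only: min.idem)
  have off: "(\<Sum>k<n. of_nat (m + n - 1 - 2 * k) * hvar (m + n - 1 - k) * hvar k) = pair_coeff m n" if "n < m" for m n
    using that by (simp add: pair_coeff_def)
  have 1: "Sum_any (\<lambda>n. (\<Sum>k<n. of_nat (2 * n - 1 - 2 * k) * hvar (2 * n - 1 - k) * hvar k) * dh n (dh n p)
       when 1 \<le> n) = (\<Sum>n\<in>{1..M}. pair_coeff n n * dh n (dh n p))"
    unfolding diag
  proof (subst Sum_any.expand_superset[of "{1..M}"])
    show "{n. (pair_coeff n n * dh n (dh n p) when 1 \<le> n) \<noteq> 0} \<subseteq> {1..M}"
      using vanish2 by (auto simp: when_def not_le split: if_splits) (meson mult_zero_right not_le)
  qed (auto intro!: sum.cong)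
  have 2: "Sum_any (\<lambda>(m, n).
       (\<Sum>k<n. of_nat (m + n - 1 - 2 * k) * hvar (m + n - 1 - k) * hvar k) * dh m (dh n p)
       when 1 \<le> n \<and> n < m)
       = (\<Sum>(m, n)\<in>{1..M} \<times> {1..M}. if n < m then pair_coeff m n * dh m (dh n p) else 0)"
  proof (subst Sum_any.expand_superset[of "{1..M} \<times> {1..M}"])
    show "{a. (case a of (m, n) \<Rightarrow> (\<Sum>k<n. of_nat (m + n - 1 - 2 * k) * hvar (m + n - 1 - k) * hvar k)
        * dh m (dh n p) when 1 \<le> n \<and> n < m) \<noteq> 0} \<subseteq> {1..M} \<times> {1..M}"
      using vanish2 by (auto simp: when_def not_le split: if_splits) (meson not_le)+
  next
    show "(\<Sum>(m, n)\<in>{1..M} \<times> {1..M}. (\<Sum>k<n. of_nat (m + n - 1 - 2 * k) * hvar (m + n - 1 - k) * hvar k)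
        * dh m (dh n p) when 1 \<le> n \<and> n < m)
      = (\<Sum>(m, n)\<in>{1..M} \<times> {1..M}. if n < m then pair_coeff m n * dh m (dh n p) else 0)"
    proof (intro sum.cong refl, clarify)
      fix m n assume "m \<in> {1..M}" "n \<in> {1..M}"
      then show "((\<Sum>k<n. of_nat (m + n - 1 - 2 * k) * hvar (m + n - 1 - k) * hvar k)
          * dh m (dh n p) when 1 \<le> n \<and> n < m) = (if n < m then pair_coeff m n * dh m (dh n p) else 0)"
      proof (cases "n < m")
        case True
        with \<open>n \<in> {1..M}\<close> show ?thesis unfolding off[OF True] by simp
      qed simp
    qed
  qed simp
  have 3: "Sum_any (\<lambda>n. (- of_nat n * hvar n
        + cpoly ((z + of_nat n - 1) * (z' + of_nat n - 1)) * hvar (n - 1)) * dh n p when 1 \<le> n)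
      = (\<Sum>n\<in>{1..M}. first_order_coeff z z' n * dh n p)"
    unfolding first_order_coeff_def[symmetric]
  proof (subst Sum_any.expand_superset[of "{1..M}"])
    show "{n. (first_order_coeff z z' n * dh n p when 1 \<le> n) \<noteq> 0} \<subseteq> {1..M}"
      using vanish by (auto simp: when_def not_le split: if_splits) (meson mult_zero_right not_le)
  qed (auto intro!: sum.cong)
  have "(\<Sum>m\<in>{1..M}. \<Sum>n\<in>{1..M}. pair_coeff m n * dh m (dh n p))
      = (\<Sum>n\<in>{1..M}. pair_coeff n n * dh n (dh n p))
        + 2 * (\<Sum>(m, n)\<in>{1..M} \<times> {1..M}. if n < m then pair_coeff m n * dh m (dh n p) else 0)"
    by (rule sum_symmetric_square) (simp_all add: pair_coeff_commute dh_commute)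
  then show ?thesis
    unfolding laguerre_diffop_def 1 2 3 by simp
qed

lemma laguerre_diffop_add:
  "laguerre_diffop z z' (p + q) = laguerre_diffop z z' p + laguerre_diffop z z' q"
proof -
  obtain M M' where "\<forall>n>M. dh n p = 0" "\<forall>n>M'. dh n q = 0"
    using dh_eventually_0 by blast
  then have "\<forall>n>max M M'. dh n r = 0" if "r \<in> {p, q, p + q}" for r
    using that by (auto simp: dh_add)
  note eq = laguerre_diffop_finite[OF this]
  show ?thesis
    by (simp add: eq[of p] eq[of q] eq[of "p + q"] dh_add distrib_left sum.distrib)
qed

lemma laguerre_diffop_scale:
  "laguerre_diffop z z' (cpoly c * p) = cpoly c * laguerre_diffop z z' p"
proof -
  obtain M where "\<forall>n>M. dh n p = 0"
    using dh_eventually_0 by blast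
  then have "\<forall>n>M. dh n r = 0" if "r \<in> {p, cpoly c * p}" for r
    using that by (auto simp: dh_scale)
  note eq = laguerre_diffop_finite[OF this]
  show ?thesis
    by (simp add: eq[of p] eq[of "cpoly c * p"] dh_scale distrib_left sum_distrib_left mult.left_commute)
qed

lemma laguerre_diffop_sum:
  "laguerre_diffop z z' (\<Sum>a\<in>A. f a) = (\<Sum>a\<in>A. laguerre_diffop z z' (f a))"
proof -
  have "laguerre_diffop z z' 0 = 0"
    using laguerre_diffop_scale[of z z' 0 0] by simp
  then show ?thesis
    by (induction A rule: infinite_finite_induct) (simp_all add: laguerre_diffop_add)
qed

text \<open>
  The first-order term of a factor \<open>h\<^sub>a\<close> has the stated form for all integers \<open>a\<close>: for \<open>a \<le> 0\<close> the
  derivatives of the factor vanish, and so do \<open>h\<^bsub>a-1\<^esub>\<close> and \<open>a h\<^sub>a\<close>.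
\<close>

lemma laguerre_diffop_prod:
  fixes a :: "'i \<Rightarrow> int"
  assumes I: "finite I"
  shows "laguerre_diffop z z' (\<Prod>i\<in>I. h_int (a i))
    = (\<Sum>i\<in>I. (cpoly ((z + of_int (a i) - 1) * (z' + of_int (a i) - 1)) * h_int (a i - 1)
          - of_int (a i) * h_int (a i)) * (\<Prod>j\<in>I - {i}. h_int (a j)))
      + (\<Sum>i\<in>I. \<Sum>j\<in>I - {i}. pair_coeff (nat (a i)) (nat (a j)) * (\<Prod>k\<in>I - {i} - {j}. h_int (a k)))"
proof -
  define M where "M = (\<Sum>i\<in>I. nat (a i))"
  have M: "nat (a i) \<le> M" if "i \<in> I" for i
    using that I unfolding M_def by (intro member_le_sum) auto
  have dh1: "dh n (\<Prod>i\<in>I. h_int (a i)) = (\<Sum>i\<in>I. if int n = a i then \<Prod>j\<in>I - {i}. h_int (a j) else 0)"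
    if "n \<ge> 1" for n
    using that I by (auto simp: dh_prod dh_h_int intro!: sum.cong)
  have dh_sum: "dh n (sum f A) = (\<Sum>x\<in>A. dh n (f x))" for n A and f :: "'i \<Rightarrow> cmpoly"
    by (simp add: dh_def pdiff_sum)
  have dh2: "dh m (dh n (\<Prod>i\<in>I. h_int (a i))) = (\<Sum>i\<in>I. if int n = a i then
      (\<Sum>j\<in>I - {i}. if int m = a j then \<Prod>k\<in>I - {i} - {j}. h_int (a k) else 0) else 0)"
    if "n \<ge> 1" "m \<ge> 1" for n m
    using that I
    by (simp add: dh1 dh_sum if_distrib[of "dh m"] dh_prod dh_h_int eq_commute[of "a _"]
        if_distrib[of "\<lambda>x. x * _"] cong: if_cong)
  have vanish: "\<forall>n>M. dh n (\<Prod>i\<in>I. h_int (a i)) = 0"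
    using M by (force simp: dh1 intro!: sum.neutral)
  have pick: "(\<Sum>n\<in>{1..M}. if int n = a i then f n else 0) = (if a i \<ge> 1 then f (nat (a i)) else 0)"
    if "i \<in> I" for i and f :: "nat \<Rightarrow> cmpoly"
  proof (cases "a i \<ge> 1")
    case True
    then have "(int n = a i) = (n = nat (a i))" for n by auto
    with True M[OF that] show ?thesis by auto
  qed (auto intro!: sum.neutral)
  have first: "(\<Sum>n\<in>{1..M}. first_order_coeff z z' n * dh n (\<Prod>i\<in>I. h_int (a i)))
     = (\<Sum>i\<in>I. (cpoly ((z + of_int (a i) - 1) * (z' + of_int (a i) - 1)) * h_int (a i - 1)
          - of_int (a i) * h_int (a i)) * (\<Prod>j\<in>I - {i}. h_int (a j)))" (is "?L = ?R")
  proof -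
    have "?L = (\<Sum>n\<in>{1..M}. \<Sum>i\<in>I. if int n = a i then first_order_coeff z z' n * (\<Prod>j\<in>I - {i}. h_int (a j)) else 0)"
      by (simp add: dh1 sum_distrib_left if_distrib cong: if_cong)
    also have "\<dots> = (\<Sum>i\<in>I. \<Sum>n\<in>{1..M}. if int n = a i then first_order_coeff z z' n * (\<Prod>j\<in>I - {i}. h_int (a j)) else 0)"
      by (rule sum.swap)
    also have "\<dots> = (\<Sum>i\<in>I. if a i \<ge> 1 then first_order_coeff z z' (nat (a i)) * (\<Prod>j\<in>I - {i}. h_int (a j)) else 0)"
      by (intro sum.cong refl pick)
    also have "\<dots> = ?R"
    proof (rule sum.cong)
      fix i assume "i \<in> I"
      show "(if a i \<ge> 1 then first_order_coeff z z' (nat (a i)) * (\<Prod>j\<in>I - {i}. h_int (a j)) else 0)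
         = (cpoly ((z + of_int (a i) - 1) * (z' + of_int (a i) - 1)) * h_int (a i - 1)
          - of_int (a i) * h_int (a i)) * (\<Prod>j\<in>I - {i}. h_int (a j))"
      proof (cases "a i \<ge> 1")
        case True
        then obtain n where "a i = int n" "n \<ge> 1" using zero_le_imp_eq_int[of "a i"] by auto
        then show ?thesis by (simp add: first_order_coeff_def h_int_def nat_diff_distrib)
      next
        case False
        then show ?thesis by (auto simp: h_int_def)
      qed
    qed simp
    finally show ?thesis .
  qed
  have second: "(\<Sum>m\<in>{1..M}. \<Sum>n\<in>{1..M}. pair_coeff m n * dh m (dh n (\<Prod>i\<in>I. h_int (a i))))
     = (\<Sum>i\<in>I. \<Sum>j\<in>I - {i}. pair_coeff (nat (a i)) (nat (a j)) * (\<Prod>k\<in>I - {i} - {j}. h_int (a k)))" (is "?L = ?R")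
  proof -
    have "?L = (\<Sum>m\<in>{1..M}. \<Sum>n\<in>{1..M}. \<Sum>i\<in>I. if int n = a i then
        pair_coeff m n * (\<Sum>j\<in>I - {i}. if int m = a j then \<Prod>k\<in>I - {i} - {j}. h_int (a k) else 0) else 0)"
      by (simp add: dh2 sum_distrib_left if_distrib cong: if_cong)
    also have "\<dots> = (\<Sum>m\<in>{1..M}. \<Sum>i\<in>I. \<Sum>n\<in>{1..M}. if int n = a i then
        pair_coeff m n * (\<Sum>j\<in>I - {i}. if int m = a j then \<Prod>k\<in>I - {i} - {j}. h_int (a k) else 0) else 0)"
      by (intro sum.cong refl sum.swap)
    also have "\<dots> = (\<Sum>m\<in>{1..M}. \<Sum>i\<in>I.
        pair_coeff m (nat (a i)) * (\<Sum>j\<in>I - {i}. if int m = a j then \<Prod>k\<in>I - {i} - {j}. h_int (a k) else 0))"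
      by (intro sum.cong refl) (simp only: pick, auto)
    also have "\<dots> = (\<Sum>m\<in>{1..M}. \<Sum>i\<in>I. \<Sum>j\<in>I - {i}.
        if int m = a j then pair_coeff m (nat (a i)) * (\<Prod>k\<in>I - {i} - {j}. h_int (a k)) else 0)"
      by (simp add: sum_distrib_left if_distrib cong: if_cong)
    also have "\<dots> = (\<Sum>i\<in>I. \<Sum>j\<in>I - {i}. \<Sum>m\<in>{1..M}.
        if int m = a j then pair_coeff m (nat (a i)) * (\<Prod>k\<in>I - {i} - {j}. h_int (a k)) else 0)"
      by (subst sum.swap) (intro sum.cong refl sum.swap)
    also have "\<dots> = (\<Sum>i\<in>I. \<Sum>j\<in>I - {i}.
        pair_coeff (nat (a j)) (nat (a i)) * (\<Prod>k\<in>I - {i} - {j}. h_int (a k)))"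
      by (intro sum.cong refl, subst pick) auto
    also have "\<dots> = ?R"
      by (simp add: pair_coeff_commute)
    finally show ?thesis .
  qed
  show ?thesis
    unfolding laguerre_diffop_finite[OF vanish] first second by (rule add.commute)
qed

section \<open>The Vandermonde product and its derivatives\<close>

lemma det_vandermonde:
  fixes x :: "nat \<Rightarrow> 'a::comm_ring_1"
  shows "det (mat l l (\<lambda>(i, j). x i ^ j)) = (\<Prod>i<l. \<Prod>j<i. x i - x j)"
proof (induction l)
  case 0
  then show ?case by (simp add: det_dim_zero)
next
  case (Suc l)
  define M where "M = mat (Suc l) (Suc l) (\<lambda>(i, j). x i ^ j)"
  define U where "U = mat (Suc l) (Suc l) (\<lambda>(i, j). if i = j then 1 else if j = Suc i then - x l else 0)"
  define A where "A = mat (Suc l) (Suc l) (\<lambda>(i, j). if j = 0 then 1 else x i ^ (j - 1) * (x i - x l))"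
  have carrier: "M \<in> carrier_mat (Suc l) (Suc l)" "U \<in> carrier_mat (Suc l) (Suc l)" "A \<in> carrier_mat (Suc l) (Suc l)"
    by (auto simp: M_def U_def A_def)
  have "upper_triangular U"
    by (auto simp: U_def upper_triangular_def)
  moreover have "diag_mat U = replicate (Suc l) 1"
    by (rule nth_equalityI) (auto simp: U_def diag_mat_def simp del: upt_Suc replicate_Suc)
  ultimately have "det U = 1"
    using carrier by (simp add: det_upper_triangular)
  \<comment> \<open>Subtract \<open>x l\<close> times each column from the next one; this clears row \<open>l\<close> except for column \<open>0\<close>.\<close>
  have "M * U = A"
  proof (rule eq_matI)
    fix i j assume "i < dim_row A" "j < dim_col A"
    then have ij: "i < Suc l" "j < Suc l" by (auto simp: A_def)
    have "(M * U) $$ (i, j) = (\<Sum>k\<in>{0..<Suc l}. x i ^ k * (if k = j then 1 else if j = Suc k then - x l else 0))"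
      using ij by (simp add: M_def U_def scalar_prod_def)
    also have "\<dots> = (\<Sum>k\<in>{0..<Suc l}. (if k = j then x i ^ j else 0) + (if j = Suc k then - x l * x i ^ (j - 1) else 0))"
      by (intro sum.cong) auto
    also have "\<dots> = x i ^ j + (\<Sum>k\<in>{0..<Suc l}. if j = Suc k then - x l * x i ^ (j - 1) else 0)"
      using ij by (simp add: sum.distrib del: sum.op_ivl_Suc)
    also have "\<dots> = A $$ (i, j)"
      using ij by (cases j) (auto simp: A_def algebra_simps simp del: sum.op_ivl_Suc)
    finally show "(M * U) $$ (i, j) = A $$ (i, j)" .
  qed (auto simp: M_def U_def A_def)
  then have "det M = det A"
    using det_mult[OF carrier(1,2)] \<open>det U = 1\<close> by simp
  also have "\<dots> = (\<Sum>j<Suc l. A $$ (l, j) * cofactor A l j)"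
    using carrier by (intro laplace_expansion_row) auto
  also have "\<dots> = (\<Sum>j<Suc l. if j = 0 then cofactor A l j else 0)"
    by (intro sum.cong) (auto simp: A_def)
  also have "\<dots> = (-1) ^ l * det (mat_delete A l 0)"
    by (simp add: cofactor_def del: sum.lessThan_Suc)
  also have "mat_delete A l 0 = mat l l (\<lambda>(i, j). (x i - x l) * x i ^ j)"
    by (rule eq_matI) (auto simp: mat_delete_def A_def mult.commute)
  also have "det \<dots> = (\<Prod>i<l. x i - x l) * det (mat l l (\<lambda>(i, j). x i ^ j))"
    by (subst (1 2) det_def')
      (auto simp: sum_distrib_left prod.distrib atLeast0LessThan permutes_in_image intro!: sum.cong)
  also have "(-1) ^ l * ((\<Prod>i<l. x i - x l) * det (mat l l (\<lambda>(i, j). x i ^ j)))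
      = (\<Prod>i<l. - (x i - x l)) * det (mat l l (\<lambda>(i, j). x i ^ j))"
    by (subst prod_uminus) (simp add: mult.assoc)
  finally show ?case
    by (simp add: M_def Suc.IH mult.commute)
qed

abbreviation perms :: "nat \<Rightarrow> (nat \<Rightarrow> nat) set" where
  "perms l \<equiv> {\<tau>. \<tau> permutes {0..<l}}"

text \<open>
  The Vandermonde product in auxiliary variables \<open>u\<^sub>0, \<dots>, u\<^bsub>l-1\<^esub>\<close>.  Its monomials enumerate the
  permutations in the Leibniz expansion of an \<open>l \<times> l\<close> determinant.
\<close>

definition vandermonde :: "nat \<Rightarrow> cmpoly" where
  "vandermonde l = (\<Prod>(a, b) | b < a \<and> a < l. vpoly a - vpoly b)"

lemma finite_pairs: "finite {(a, b). b < a \<and> a < (l::nat)}"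
  by (rule finite_subset[of _ "{..<l} \<times> {..<l}"]) auto

lemma vandermonde_eq_det: "vandermonde l = det (mat l l (\<lambda>(i, j). vpoly i ^ j))"
proof -
  have "{(a, b). b < a \<and> a < l} = Sigma {..<l} (\<lambda>a. {..<a})"
    by auto
  then show ?thesis
    by (simp add: vandermonde_def det_vandermonde prod.Sigma)
qed

lemma vandermonde_eq_sum:
  "vandermonde l = (\<Sum>\<tau>\<in>perms l. signof \<tau> * Poly_Mapping.single (\<Sum>i<l. Poly_Mapping.single i (\<tau> i)) 1)"
  unfolding vandermonde_eq_det
  by (subst det_def'[of _ l])
    (auto simp: vpoly_power prod_single_1 atLeast0LessThan permutes_in_image[of _ "{..<l}"] intro!: sum.cong arg_cong2[of _ _ _ _ "(*)"] prod.cong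
      simp flip: prod_single_1)

text \<open>
  The quotient of the Vandermonde product by \<open>u\<^sub>i - u\<^sub>j\<close>, for \<open>i \<noteq> j\<close>.  The product has the factors
  \<open>u\<^sub>a - u\<^sub>b\<close> with \<open>a > b\<close>, whence the sign for \<open>i < j\<close>.
\<close>

definition vandermonde_quot :: "nat \<Rightarrow> nat \<Rightarrow> nat \<Rightarrow> cmpoly" where
  "vandermonde_quot l i j = (if j < i then 1 else - 1) *
     (\<Prod>(a, b)\<in>{(a, b). b < a \<and> a < l} - {(max i j, min i j)}. vpoly a - vpoly b)"

lemma vandermonde_quot_swap: "i \<noteq> j \<Longrightarrow> vandermonde_quot l j i = - vandermonde_quot l i j"
  by (auto simp: vandermonde_quot_def max.commute min.commute)

lemma vandermonde_eq_quot:
  assumes "i \<noteq> j" "i < l" "j < l"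
  shows "vandermonde l = (vpoly i - vpoly j) * vandermonde_quot l i j"
proof -
  have "(max i j, min i j) \<in> {(a, b). b < a \<and> a < l}"
    using assms by auto
  from prod.remove[OF finite_pairs this, of "\<lambda>(a, b). vpoly a - vpoly b"] show ?thesis
    using assms by (auto simp: vandermonde_def vandermonde_quot_def max_def min_def algebra_simps)
qed

lemma pdiff_vandermonde:
  assumes "i < l"
  shows "pdiff i (vandermonde l) = (\<Sum>j\<in>{..<l} - {i}. vandermonde_quot l i j)"
proof -
  let ?P = "{(a, b). b < a \<and> a < l}"
  let ?R = "\<lambda>p. \<Prod>(a, b)\<in>?P - {p}. vpoly a - vpoly b"
  have "pdiff i (vandermonde l) = (\<Sum>p\<in>?P. pdiff i (case p of (a, b) \<Rightarrow> vpoly a - vpoly b) * ?R p)"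
    unfolding vandermonde_def by (rule pdiff_prod[OF finite_pairs])
  also have "\<dots> = (\<Sum>p\<in>?P. (if fst p = i then ?R p else 0) - (if snd p = i then ?R p else 0))"
    by (intro sum.cong refl) (auto simp: pdiff_diff pdiff_vpoly)
  also have "\<dots> = (\<Sum>p\<in>?P \<inter> {p. fst p = i}. ?R p) - (\<Sum>p\<in>?P \<inter> {p. snd p = i}. ?R p)"
    by (simp only: sum_subtractf sum.inter_restrict[OF finite_pairs] mem_Collect_eq)
  also have "?P \<inter> {p. fst p = i} = (\<lambda>j. (i, j)) ` {..<i}"
    using assms by auto
  also have "?P \<inter> {p. snd p = i} = (\<lambda>j. (j, i)) ` {i<..<l}"
    by auto
  also have "(\<Sum>p\<in>(\<lambda>j. (i, j)) ` {..<i}. ?R p) - (\<Sum>p\<in>(\<lambda>j. (j, i)) ` {i<..<l}. ?R p)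
     = (\<Sum>j<i. vandermonde_quot l i j) + (\<Sum>j\<in>{i<..<l}. vandermonde_quot l i j)"
    by (subst (1 2) sum.reindex)
      (auto simp: inj_on_def vandermonde_quot_def max_def min_def diff_conv_add_uminus sum_negf[symmetric]
        simp del: add_uminus_conv_diff
        intro!: arg_cong2[of _ _ _ _ "(+)"] sum.cong)
  also have "\<dots> = (\<Sum>j\<in>{..<i} \<union> {i<..<l}. vandermonde_quot l i j)"
    by (rule sum.union_disjoint[symmetric]) auto
  also have "{..<i} \<union> {i<..<l} = {..<l} - {i}"
    using assms by auto
  finally show ?thesis .
qed

section \<open>The differential operator on Jacobi--Trudi determinants\<close>

text \<open>
  For a partition \<open>\<nu>\<close> with at most \<open>l\<close> parts, \<open>m i = \<nu>\<^sub>i - i\<close> gives the usual determinant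
  \<open>det (h(\<nu>\<^sub>i - i + j))\<close>.
\<close>

definition jacobi_trudi :: "nat \<Rightarrow> (nat \<Rightarrow> int) \<Rightarrow> cmpoly" where
  "jacobi_trudi l m = det (mat l l (\<lambda>(i, j). h_int (m i + int j)))"

lemma jacobi_trudi_eq_sum:
  "jacobi_trudi l m = (\<Sum>\<tau>\<in>perms l. signof \<tau> * (\<Prod>k<l. h_int (m k + int (\<tau> k))))"
  unfolding jacobi_trudi_def
  by (subst det_def'[of _ l])
    (auto simp: atLeast0LessThan permutes_in_image[of _ "{..<l}"] intro!: sum.cong arg_cong2[of _ _ _ _ "(*)"] prod.cong)

text \<open>
  The term of the permutation \<open>\<tau>\<close> in the Leibniz expansion of \<open>jacobi_trudi l m\<close>, with the index of the
  factor in row \<open>i\<close> lowered by one.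
\<close>

abbreviation lowered_prod :: "nat \<Rightarrow> (nat \<Rightarrow> int) \<Rightarrow> nat \<Rightarrow> (nat \<Rightarrow> nat) \<Rightarrow> cmpoly" where
  "lowered_prod l m i \<tau> \<equiv> (\<Prod>k<l. h_int (m k + int (\<tau> k) - (if k = i then 1 else 0)))"

lemma jacobi_trudi_lower:
  "jacobi_trudi l (m(i := m i - 1)) = (\<Sum>\<tau>\<in>perms l. signof \<tau> * lowered_prod l m i \<tau>)"
  unfolding jacobi_trudi_eq_sum
  by (intro sum.cong arg_cong2[of _ _ _ _ "(*)"] prod.cong refl arg_cong[of _ _ h_int]) auto

text \<open>
  Grouped by the column \<open>c\<close> of the lowered factor, the sum consists of multiples \<open>f c\<close> of determinants
  whose column \<open>c\<close> is lowered.  For \<open>c > 0\<close> this column agrees with column \<open>c - 1\<close>.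
\<close>

lemma sum_lowered_prod:
  assumes "f 0 = 0"
  shows "(\<Sum>\<tau>\<in>perms l. signof \<tau> * (\<Sum>i<l. of_nat (f (\<tau> i)) * lowered_prod l m i \<tau>)) = 0"
proof -
  define e where "e c j = int j - (if j = c then 1 else 0)" for c j :: nat
  let ?A = "\<lambda>c. mat l l (\<lambda>(i, j). h_int (m i + e c j))"
  have "(\<Sum>\<tau>\<in>perms l. signof \<tau> * (\<Sum>i<l. of_nat (f (\<tau> i)) * lowered_prod l m i \<tau>))
    = (\<Sum>\<tau>\<in>perms l. signof \<tau> * (\<Sum>c<l. of_nat (f c) * (\<Prod>k<l. h_int (m k + e c (\<tau> k)))))"
  proof (rule sum.cong[OF refl], rule arg_cong2[of _ _ _ _ "(*)", OF refl])
    fix \<tau> assume "\<tau> \<in> perms l"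
    then have \<tau>: "\<tau> permutes {..<l}" by (simp add: atLeast0LessThan)
    have "(\<Sum>i<l. of_nat (f (\<tau> i)) * lowered_prod l m i \<tau>)
       = (\<Sum>i<l. of_nat (f (\<tau> i)) * (\<Prod>k<l. h_int (m k + e (\<tau> i) (\<tau> k))))"
      using permutes_inj[OF \<tau>]
      by (intro sum.cong arg_cong2[of _ _ _ _ "(*)"] prod.cong refl arg_cong[of _ _ h_int])
        (auto simp: e_def inj_eq)
    also have "\<dots> = (\<Sum>c<l. of_nat (f c) * (\<Prod>k<l. h_int (m k + e c (\<tau> k))))"
      using sum.permute[OF \<tau>, of "\<lambda>c. of_nat (f c) * (\<Prod>k<l. h_int (m k + e c (\<tau> k)))"]
      by (simp add: o_def)
    finally show "(\<Sum>i<l. of_nat (f (\<tau> i)) * lowered_prod l m i \<tau>)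
       = (\<Sum>c<l. of_nat (f c) * (\<Prod>k<l. h_int (m k + e c (\<tau> k))))" .
  qed
  also have "\<dots> = (\<Sum>c<l. of_nat (f c) * (\<Sum>\<tau>\<in>perms l. signof \<tau> * (\<Prod>k<l. h_int (m k + e c (\<tau> k)))))"
    by (simp add: sum_distrib_left mult.left_commute) (rule sum.swap)
  also have "\<dots> = (\<Sum>c<l. of_nat (f c) * det (?A c))"
    by (subst det_def'[of _ l])
      (auto simp: atLeast0LessThan permutes_in_image[of _ "{..<l}"] intro!: sum.cong arg_cong2[of _ _ _ _ "(*)"] prod.cong)
  also have "\<dots> = 0"
  proof (intro sum.neutral ballI)
    fix c assume c: "c \<in> {..<l}"
    show "of_nat (f c) * det (?A c) = 0"
    proof (cases "c = 0")
      case False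
      have "det (?A c) = 0"
        by (rule det_identical_columns[of _ l c "c - 1"])
          (use c False in \<open>auto simp: e_def of_nat_diff intro!: eq_vecI\<close>)
      then show ?thesis by simp
    qed (simp add: assms)
  qed
  finally show ?thesis .
qed

text \<open>
  Two linear functionals on polynomials in the auxiliary variables \<open>u\<close>.  Applied to the Vandermonde product,
  they produce the second-order term of \<open>L J\<close> for the rows \<open>i\<close> and \<open>j\<close>, and \<open>J\<close> itself.
\<close>

definition pair_functional :: "nat \<Rightarrow> (nat \<Rightarrow> int) \<Rightarrow> nat \<Rightarrow> nat \<Rightarrow> cmpoly \<Rightarrow> cmpoly" where
  "pair_functional l m i j = lin_ext (\<lambda>t.
     pair_coeff (nat (m i + int (Poly_Mapping.lookup t i))) (nat (m j + int (Poly_Mapping.lookup t j)))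
     * (\<Prod>k\<in>{..<l} - {i} - {j}. h_int (m k + int (Poly_Mapping.lookup t k))))"

definition prod_functional :: "nat \<Rightarrow> (nat \<Rightarrow> int) \<Rightarrow> cmpoly \<Rightarrow> cmpoly" where
  "prod_functional l m = lin_ext (\<lambda>t. \<Prod>k<l. h_int (m k + int (Poly_Mapping.lookup t k)))"

text \<open>
  The functional \<open>p \<mapsto> \<Phi>((m\<^sub>i + u\<^sub>i \<partial>/\<partial>u\<^sub>i) p)\<close> for \<open>\<Phi> = prod_functional l m\<close>; the operator multiplies
  a monomial by the index of the factor in row \<open>i\<close> that it is sent to.
\<close>

definition shifted_euler :: "nat \<Rightarrow> (nat \<Rightarrow> int) \<Rightarrow> nat \<Rightarrow> cmpoly \<Rightarrow> cmpoly" where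
  "shifted_euler l m i p = of_int (m i) * prod_functional l m p + prod_functional l m (vpoly i * pdiff i p)"

lemma prod_functional_add: "prod_functional l m (p + q) = prod_functional l m p + prod_functional l m q"
  and prod_functional_minus: "prod_functional l m (- p) = - prod_functional l m p"
  by (simp_all add: prod_functional_def lin_ext_add lin_ext_minus)

lemma pair_functional_add: "pair_functional l m i j (p + q) = pair_functional l m i j p + pair_functional l m i j q"
  by (simp add: pair_functional_def lin_ext_add)

lemma shifted_euler_add: "shifted_euler l m i (p + q) = shifted_euler l m i p + shifted_euler l m i q"
  and shifted_euler_minus: "shifted_euler l m i (- p) = - shifted_euler l m i p"
  by (simp_all add: shifted_euler_def pdiff_add pdiff_minus prod_functional_add prod_functional_minus
      distrib_left)

lemma shifted_euler_sum: "shifted_euler l m i (\<Sum>a\<in>A. f a) = (\<Sum>a\<in>A. shifted_euler l m i (f a))"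
proof -
  have "shifted_euler l m i 0 = 0" using shifted_euler_add[of l m i 0 0] by simp
  then show ?thesis
    by (induction A rule: infinite_finite_induct) (simp_all add: shifted_euler_add)
qed

text \<open>
  The recurrence for the second-order coefficients, in terms of functionals.
\<close>

lemma pair_functional_mult_diff:
  assumes ij: "i \<noteq> j" "i < l" "j < l"
  shows "pair_functional l m i j ((vpoly i - vpoly j) * p) = shifted_euler l m j p - shifted_euler l m i p"
proof (induction p rule: cmpoly_induct)
  case (monomial t c)
  let ?a = "\<lambda>k. m k + int (Poly_Mapping.lookup t k)"
  let ?P = "\<Prod>k\<in>{..<l} - {i} - {j}. h_int (?a k)"
  have split: "(\<Prod>k<l. h_int (?a k)) = h_int (?a i) * h_int (?a j) * ?P"
    using ij by (simp add: prod.remove[of "{..<l}" i] prod.remove[of "{..<l} - {i}" j] mult.assoc)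
  have pair: "pair_functional l m i j (vpoly k * Poly_Mapping.single t c)
      = cpoly c * (pair_coeff (nat (?a i + (if k = i then 1 else 0))) (nat (?a j + (if k = j then 1 else 0))) * ?P)"
    if "k \<in> {i, j}" for k
    using that ij
    by (auto simp: pair_functional_def vpoly_def mult_single lookup_add lookup_monomial_single ac_simps
        intro!: prod.cong)
  have euler: "shifted_euler l m k (Poly_Mapping.single t c)
      = cpoly c * of_int (?a k) * (h_int (?a i) * h_int (?a j) * ?P)" for k
  proof -
    have "vpoly k * pdiff k (Poly_Mapping.single t c) = Poly_Mapping.single t (of_nat (Poly_Mapping.lookup t k) * c)"
    proof (cases "Poly_Mapping.lookup t k = 0")
      case False
      then have "Poly_Mapping.single k 1 + (t - Poly_Mapping.single k 1) = t"
        by (intro poly_mapping_eqI) (auto simp: lookup_add lookup_minus lookup_monomial_single)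
      then show ?thesis by (simp add: pdiff_monomial vpoly_def mult_single)
    qed (simp add: pdiff_monomial)
    then show ?thesis
      by (simp add: shifted_euler_def prod_functional_def split cpoly_mult cpoly_of_nat algebra_simps)
  qed
  have "pair_functional l m i j ((vpoly i - vpoly j) * Poly_Mapping.single t c)
     = pair_functional l m i j (vpoly i * Poly_Mapping.single t c)
       - pair_functional l m i j (vpoly j * Poly_Mapping.single t c)"
    by (simp add: left_diff_distrib pair_functional_def lin_ext_diff)
  also have "\<dots> = - (cpoly c * ((pair_coeff (nat (?a i)) (nat (?a j + 1)) - pair_coeff (nat (?a i + 1)) (nat (?a j))) * ?P))"
    using ij by (simp add: pair algebra_simps)
  also have "\<dots> = shifted_euler l m j (Poly_Mapping.single t c) - shifted_euler l m i (Poly_Mapping.single t c)"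
    unfolding pair_coeff_int_shift euler by (simp add: algebra_simps)
  finally show ?case .
next
  case (add p q)
  then show ?case
    by (simp add: distrib_left pair_functional_add shifted_euler_add)
qed

lemma lin_ext_signof: "lin_ext \<phi> (signof \<tau> * p) = signof \<tau> * lin_ext \<phi> p"
  using lin_ext_scale[of \<phi> "of_int (sign \<tau>)" p] by (simp only: cpoly_of_int)

lemma pdiff_signof: "pdiff i (signof \<tau> * p) = signof \<tau> * pdiff i p"
  by (simp only: pdiff_eq_lin_ext lin_ext_signof)

lemma lookup_exponent:
  fixes k l :: nat
  shows "Poly_Mapping.lookup (\<Sum>i<l. Poly_Mapping.single i (\<tau> i)) k = (if k < l then \<tau> k else (0::nat))"
  unfolding lookup_sum lookup_monomial_single by (subst sum.delta) auto

lemma prod_functional_pdiff_vandermonde: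
  assumes "i < l"
  shows "prod_functional l m (pdiff i (vandermonde l))
      = (\<Sum>\<tau>\<in>perms l. signof \<tau> * (of_nat (\<tau> i) * lowered_prod l m i \<tau>))"
    and "prod_functional l m (vpoly i * pdiff i (pdiff i (vandermonde l)))
      = (\<Sum>\<tau>\<in>perms l. signof \<tau> * (of_nat (\<tau> i * (\<tau> i - 1)) * lowered_prod l m i \<tau>))"
proof -
  define t where "t \<tau> = (\<Sum>i<l. Poly_Mapping.single i (\<tau> i))" for \<tau> :: "nat \<Rightarrow> nat"
  have lookup_t: "Poly_Mapping.lookup (t \<tau>) k = \<tau> k" if "k < l" for \<tau> k
    using that by (simp add: t_def lookup_exponent)
  have "prod_functional l m (Poly_Mapping.single (t \<tau> - Poly_Mapping.single i 1) (of_nat (n * \<tau> i)))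
      = of_nat (n * \<tau> i) * lowered_prod l m i \<tau>" for n \<tau>
  proof (cases "\<tau> i = 0")
    case False
    then have "(\<Prod>k<l. h_int (m k + int (Poly_Mapping.lookup (t \<tau> - Poly_Mapping.single i 1) k))) = lowered_prod l m i \<tau>"
      by (intro prod.cong refl arg_cong[of _ _ h_int])
        (auto simp: lookup_minus lookup_monomial_single lookup_t of_nat_diff)
    then show ?thesis
      unfolding prod_functional_def lin_ext_single cpoly_of_nat by simp
  qed (simp add: prod_functional_def)
  note functional = this
  show "prod_functional l m (pdiff i (vandermonde l))
      = (\<Sum>\<tau>\<in>perms l. signof \<tau> * (of_nat (\<tau> i) * lowered_prod l m i \<tau>))"
    using assms functional[of _ 1]
    unfolding vandermonde_eq_sum t_def[symmetric] pdiff_sum pdiff_signof pdiff_monomial prod_functional_def lin_ext_sum lin_ext_signof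
    by (simp add: lookup_t)
  have "vpoly i * pdiff i (pdiff i (Poly_Mapping.single (t \<tau>) 1))
     = Poly_Mapping.single (t \<tau> - Poly_Mapping.single i 1) (of_nat ((\<tau> i - 1) * \<tau> i))" for \<tau>
  proof (cases "\<tau> i \<le> 1")
    case False
    then have "Poly_Mapping.single i 1 + (t \<tau> - Poly_Mapping.single i 1 - Poly_Mapping.single i 1) = t \<tau> - Poly_Mapping.single i 1"
      using assms by (intro poly_mapping_eqI) (auto simp: lookup_add lookup_minus lookup_monomial_single lookup_t)
    then show ?thesis
      using assms by (simp add: pdiff_monomial vpoly_def mult_single lookup_minus lookup_t)
  next
    case True
    then have "\<tau> i = 0 \<or> \<tau> i = 1" by linarith
    then show ?thesis
      using assms by (auto simp: pdiff_monomial lookup_minus lookup_t)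
  qed
  note second = this
  show "prod_functional l m (vpoly i * pdiff i (pdiff i (vandermonde l)))
      = (\<Sum>\<tau>\<in>perms l. signof \<tau> * (of_nat (\<tau> i * (\<tau> i - 1)) * lowered_prod l m i \<tau>))"
    unfolding vandermonde_eq_sum t_def[symmetric] pdiff_sum pdiff_signof sum_distrib_left
      mult.left_commute[of "vpoly i"] second
      prod_functional_def lin_ext_sum lin_ext_signof functional[unfolded prod_functional_def]
    by (simp only: mult.commute[of "\<tau> i - 1" "\<tau> i" for \<tau>])
qed

text \<open>
  Writing \<open>V = (u\<^sub>i - u\<^sub>j) Q\<^bsub>ij\<^esub>\<close> with \<open>Q\<^bsub>ji\<^esub> = - Q\<^bsub>ij\<^esub>\<close> turns the sum into
  \<open>- 2 \<Phi>(\<Sum>\<^sub>i (m\<^sub>i + u\<^sub>i \<partial>\<^sub>i) \<partial>\<^sub>i V)\<close>, in which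
  \<open>\<Sum>\<^sub>i u\<^sub>i \<partial>\<^sub>i\<^sup>2 V\<close> does not contribute by \<open>sum_lowered_prod\<close>.
\<close>

lemma sum_pair_functional_vandermonde:
  "(\<Sum>i<l. \<Sum>j\<in>{..<l} - {i}. pair_functional l m i j (vandermonde l))
    = - 2 * (\<Sum>i<l. of_int (m i) * (\<Sum>\<tau>\<in>perms l. signof \<tau> * (of_nat (\<tau> i) * lowered_prod l m i \<tau>)))"
proof -
  let ?Q = "vandermonde_quot l"
  let ?T = "\<lambda>i j. shifted_euler l m i (?Q i j)"
  have "(\<Sum>i<l. \<Sum>j\<in>{..<l} - {i}. pair_functional l m i j (vandermonde l))
     = (\<Sum>i<l. \<Sum>j\<in>{..<l} - {i}. - ?T j i - ?T i j)"
  proof (intro sum.cong refl)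
    fix i j assume "i \<in> {..<l}" "j \<in> {..<l} - {i}"
    then have ij: "i \<noteq> j" "i < l" "j < l" by auto
    then show "pair_functional l m i j (vandermonde l) = - ?T j i - ?T i j"
      using vandermonde_eq_quot[OF ij] vandermonde_quot_swap[of i j l]
      by (simp add: pair_functional_mult_diff shifted_euler_minus)
  qed
  also have "\<dots> = - (\<Sum>i<l. \<Sum>j\<in>{..<l} - {i}. ?T j i) - (\<Sum>i<l. \<Sum>j\<in>{..<l} - {i}. ?T i j)"
    by (simp add: sum_subtractf sum_negf)
  also have "(\<Sum>i<l. \<Sum>j\<in>{..<l} - {i}. ?T j i) = (\<Sum>i<l. \<Sum>j<l. if j \<noteq> i then ?T j i else 0)"
    by (intro sum.cong refl sum.mono_neutral_cong_left) auto
  also have "\<dots> = (\<Sum>j<l. \<Sum>i<l. if j \<noteq> i then ?T j i else 0)"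
    by (rule sum.swap)
  also have "\<dots> = (\<Sum>i<l. \<Sum>j\<in>{..<l} - {i}. ?T i j)"
    by (intro sum.cong refl sum.mono_neutral_cong_right) auto
  also have "- (\<Sum>i<l. \<Sum>j\<in>{..<l} - {i}. ?T i j) - (\<Sum>i<l. \<Sum>j\<in>{..<l} - {i}. ?T i j)
     = - 2 * (\<Sum>i<l. shifted_euler l m i (pdiff i (vandermonde l)))"
    by (simp add: pdiff_vandermonde shifted_euler_sum)
  also have "(\<Sum>i<l. shifted_euler l m i (pdiff i (vandermonde l)))
    = (\<Sum>i<l. of_int (m i) * (\<Sum>\<tau>\<in>perms l. signof \<tau> * (of_nat (\<tau> i) * lowered_prod l m i \<tau>)))
      + (\<Sum>i<l. \<Sum>\<tau>\<in>perms l. signof \<tau> * (of_nat (\<tau> i * (\<tau> i - 1)) * lowered_prod l m i \<tau>))"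
    by (simp add: shifted_euler_def prod_functional_pdiff_vandermonde sum.distrib del: of_nat_mult)
  also have "(\<Sum>i<l. \<Sum>\<tau>\<in>perms l. signof \<tau> * (of_nat (\<tau> i * (\<tau> i - 1)) * lowered_prod l m i \<tau>))
     = (\<Sum>\<tau>\<in>perms l. signof \<tau> * (\<Sum>i<l. of_nat (\<tau> i * (\<tau> i - 1)) * lowered_prod l m i \<tau>))"
    unfolding sum_distrib_left by (rule sum.swap)
  also have "\<dots> = 0"
    by (rule sum_lowered_prod[of "\<lambda>t. t * (t - 1)"]) simp
  finally show ?thesis by simp
qed

lemma laguerre_diffop_jacobi_trudi:
  "laguerre_diffop z z' (jacobi_trudi l m)
    = (\<Sum>i<l. cpoly ((z + of_int (m i) - 1) * (z' + of_int (m i) - 1)) * jacobi_trudi l (m(i := m i - 1)))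
      - of_int (\<Sum>i<l. m i + int i) * jacobi_trudi l m"
proof -
  let ?h = "\<lambda>\<tau>. \<Prod>k<l. h_int (m k + int (\<tau> k))"
  let ?W = "lowered_prod l m"
  let ?c = "\<lambda>i. cpoly ((z + of_int (m i) - 1) * (z' + of_int (m i) - 1))"
  let ?G = "\<lambda>\<tau>. \<Sum>i<l. \<Sum>j\<in>{..<l} - {i}. pair_coeff (nat (m i + int (\<tau> i))) (nat (m j + int (\<tau> j)))
      * (\<Prod>k\<in>{..<l} - {i} - {j}. h_int (m k + int (\<tau> k)))"
  define S where "S F = (\<Sum>\<tau>\<in>perms l. signof \<tau> * F \<tau>)" for F :: "(nat \<Rightarrow> nat) \<Rightarrow> cmpoly"
  have S_add: "S (\<lambda>\<tau>. F \<tau> + F' \<tau>) = S F + S F'"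
    and S_diff: "S (\<lambda>\<tau>. F \<tau> - F' \<tau>) = S F - S F'"
    and S_mult: "S (\<lambda>\<tau>. c * F \<tau>) = c * S F" for F F' c
    by (simp_all add: S_def distrib_left right_diff_distrib sum.distrib sum_subtractf sum_distrib_left mult.left_commute)
  have S_sum: "S (\<lambda>\<tau>. \<Sum>i<l. F i \<tau>) = (\<Sum>i<l. S (F i))" for F
    unfolding S_def sum_distrib_left by (rule sum.swap)
  have expand: "laguerre_diffop z z' (?h \<tau>)
      = (\<Sum>i<l. ?c i * ?W i \<tau>) + cpoly (z + z' - 1) * (\<Sum>i<l. of_nat (\<tau> i) * ?W i \<tau>)
        + (\<Sum>i<l. of_nat (\<tau> i * (\<tau> i - 1)) * ?W i \<tau>)
        + 2 * (\<Sum>i<l. of_int (m i) * (of_nat (\<tau> i) * ?W i \<tau>))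
        - of_int (\<Sum>i<l. m i + int i) * ?h \<tau> + ?G \<tau>"
    if "\<tau> \<in> perms l" for \<tau>
  proof -
    let ?a = "\<lambda>i. m i + int (\<tau> i)"
    have \<tau>: "\<tau> permutes {..<l}" using that by (simp add: atLeast0LessThan)
    have remove: "h_int (?a i) * (\<Prod>j\<in>{..<l} - {i}. h_int (?a j)) = ?h \<tau>" if "i < l" for i
      using that by (simp add: prod.remove[of "{..<l}" i])
    have lower: "h_int (?a i - 1) * (\<Prod>j\<in>{..<l} - {i}. h_int (?a j)) = ?W i \<tau>" if "i < l" for i
      using that by (simp add: prod.remove[of "{..<l}" i])
    \<comment> \<open>The weights \<open>\<tau> i\<close> and \<open>\<tau> i * (\<tau> i - 1)\<close> vanish at \<open>0\<close> and sum to zero over the permutations.\<close>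
    have coeff: "cpoly ((z + of_int (?a i) - 1) * (z' + of_int (?a i) - 1))
       = ?c i + cpoly (z + z' - 1) * of_nat (\<tau> i) + of_nat (\<tau> i * (\<tau> i - 1)) + 2 * of_int (m i) * of_nat (\<tau> i)" for i
    proof -
      have "(z + of_int (?a i) - 1) * (z' + of_int (?a i) - 1)
        = (z + of_int (m i) - 1) * (z' + of_int (m i) - 1) + (z + z' - 1) * of_nat (\<tau> i)
          + of_nat (\<tau> i * (\<tau> i - 1)) + of_int (2 * m i) * of_nat (\<tau> i)"
        by (cases "\<tau> i") (simp_all add: algebra_simps)
      then have "cpoly ((z + of_int (?a i) - 1) * (z' + of_int (?a i) - 1))
        = ?c i + cpoly (z + z' - 1) * of_nat (\<tau> i) + of_nat (\<tau> i * (\<tau> i - 1)) + of_int (2 * m i) * of_nat (\<tau> i)"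
        by (simp only: cpoly_add cpoly_mult[of _ "of_nat _"] cpoly_of_nat cpoly_of_int)
      then show ?thesis
        by (simp only: of_int_mult of_int_numeral)
    qed
    have "laguerre_diffop z z' (?h \<tau>)
      = (\<Sum>i<l. (cpoly ((z + of_int (?a i) - 1) * (z' + of_int (?a i) - 1)) * h_int (?a i - 1)
          - of_int (?a i) * h_int (?a i)) * (\<Prod>j\<in>{..<l} - {i}. h_int (?a j))) + ?G \<tau>"
      by (rule laguerre_diffop_prod) simp
    also have "(\<Sum>i<l. (cpoly ((z + of_int (?a i) - 1) * (z' + of_int (?a i) - 1)) * h_int (?a i - 1)
          - of_int (?a i) * h_int (?a i)) * (\<Prod>j\<in>{..<l} - {i}. h_int (?a j)))
       = (\<Sum>i<l. cpoly ((z + of_int (?a i) - 1) * (z' + of_int (?a i) - 1)) * ?W i \<tau> - of_int (?a i) * ?h \<tau>)"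
      using remove lower
      by (intro sum.cong refl) (simp add: left_diff_distrib mult.assoc)
    also have "\<dots> = (\<Sum>i<l. ?c i * ?W i \<tau>) + cpoly (z + z' - 1) * (\<Sum>i<l. of_nat (\<tau> i) * ?W i \<tau>)
        + (\<Sum>i<l. of_nat (\<tau> i * (\<tau> i - 1)) * ?W i \<tau>)
        + 2 * (\<Sum>i<l. of_int (m i) * (of_nat (\<tau> i) * ?W i \<tau>)) - of_int (\<Sum>i<l. ?a i) * ?h \<tau>"
      unfolding coeff of_int_sum[of ?a] sum_distrib_right[of "\<lambda>i. of_int (?a i)"]
      by (simp add: distrib_right sum.distrib sum_subtractf sum_distrib_left sum_distrib_right mult.assoc
          del: of_nat_mult of_int_add)
    also have "(\<Sum>i<l. ?a i) = (\<Sum>i<l. m i + int i)"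
      using sum.permute[OF \<tau>, of int] by (simp add: sum.distrib o_def)
    finally show ?thesis .
  qed
  have "jacobi_trudi l m = S ?h" unfolding S_def by (rule jacobi_trudi_eq_sum)
  have "laguerre_diffop z z' (signof \<tau> * p) = signof \<tau> * laguerre_diffop z z' p" for \<tau> p
    using laguerre_diffop_scale[of z z' "of_int (sign \<tau>)" p] by (simp only: cpoly_of_int)
  then have "laguerre_diffop z z' (jacobi_trudi l m) = S (\<lambda>\<tau>. laguerre_diffop z z' (?h \<tau>))"
    by (simp add: jacobi_trudi_eq_sum laguerre_diffop_sum S_def)
  also have "\<dots> = S (\<lambda>\<tau>. (\<Sum>i<l. ?c i * ?W i \<tau>) + cpoly (z + z' - 1) * (\<Sum>i<l. of_nat (\<tau> i) * ?W i \<tau>)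
        + (\<Sum>i<l. of_nat (\<tau> i * (\<tau> i - 1)) * ?W i \<tau>)
        + 2 * (\<Sum>i<l. of_int (m i) * (of_nat (\<tau> i) * ?W i \<tau>))
        - of_int (\<Sum>i<l. m i + int i) * ?h \<tau> + ?G \<tau>)"
    unfolding S_def by (intro sum.cong refl arg_cong2[of _ _ _ _ "(*)"] expand)
  also have "\<dots> = (\<Sum>i<l. ?c i * S (?W i)) + cpoly (z + z' - 1) * S (\<lambda>\<tau>. \<Sum>i<l. of_nat (\<tau> i) * ?W i \<tau>)
        + S (\<lambda>\<tau>. \<Sum>i<l. of_nat (\<tau> i * (\<tau> i - 1)) * ?W i \<tau>)
        + 2 * (\<Sum>i<l. of_int (m i) * S (\<lambda>\<tau>. of_nat (\<tau> i) * ?W i \<tau>))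
        - of_int (\<Sum>i<l. m i + int i) * S ?h + S ?G"
    by (simp only: S_add S_diff S_mult S_sum[of "\<lambda>i \<tau>. ?c i * _ i \<tau>"] S_sum[of "\<lambda>i \<tau>. of_int (m i) * _ i \<tau>"])
  also have "S (\<lambda>\<tau>. \<Sum>i<l. of_nat (\<tau> i) * ?W i \<tau>) = 0"
    unfolding S_def by (rule sum_lowered_prod[of "\<lambda>t. t"]) simp
  also have "S (\<lambda>\<tau>. \<Sum>i<l. of_nat (\<tau> i * (\<tau> i - 1)) * ?W i \<tau>) = 0"
    unfolding S_def by (rule sum_lowered_prod[of "\<lambda>t. t * (t - 1)"]) simp
  also have "S ?G = (\<Sum>i<l. \<Sum>j\<in>{..<l} - {i}. pair_functional l m i j (vandermonde l))"
  proof -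
    have "pair_functional l m i j (vandermonde l) = S (\<lambda>\<tau>. pair_coeff (nat (m i + int (\<tau> i))) (nat (m j + int (\<tau> j)))
      * (\<Prod>k\<in>{..<l} - {i} - {j}. h_int (m k + int (\<tau> k))))" if "i < l" "j < l" for i j
      using that
      by (simp add: vandermonde_eq_sum pair_functional_def lin_ext_sum lin_ext_signof lookup_exponent S_def)
    then show ?thesis
      unfolding S_def sum_distrib_left
      by (subst sum.swap, subst sum.swap[of _ _ "perms l"]) (auto intro!: sum.cong)
  qed
  also have "\<dots> = - 2 * (\<Sum>i<l. of_int (m i) * S (\<lambda>\<tau>. of_nat (\<tau> i) * ?W i \<tau>))"
    unfolding S_def by (rule sum_pair_functional_vandermonde)
  also have "S ?h = jacobi_trudi l m"
    by (simp add: \<open>jacobi_trudi l m = S ?h\<close>)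
  finally show ?thesis
    by (simp add: jacobi_trudi_lower S_def)
qed

section \<open>The Jacobi--Trudi identity\<close>

lemma lookup_vpoly_mult:
  "Poly_Mapping.lookup (vpoly i * p) m
    = (if Poly_Mapping.lookup m i > 0 then Poly_Mapping.lookup p (m - Poly_Mapping.single i 1) else 0)"
proof (induction p rule: cmpoly_induct)
  case (monomial t c)
  have "Poly_Mapping.single i 1 + t = m \<longleftrightarrow> Poly_Mapping.lookup m i > 0 \<and> t = m - Poly_Mapping.single i 1"
  proof
    assume "Poly_Mapping.lookup m i > 0 \<and> t = m - Poly_Mapping.single i 1"
    then show "Poly_Mapping.single i 1 + t = m"
      by (intro poly_mapping_eqI) (auto simp: lookup_add lookup_minus lookup_monomial_single)
  qed (auto simp: lookup_add lookup_monomial_single)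
  then show ?case
    by (auto simp: vpoly_def mult_single lookup_single when_def)
qed (simp add: distrib_left lookup_add)

lemma complete_h_Suc_Suc:
  "complete_h (Suc n) (Suc N) = complete_h (Suc n) N + vpoly N * complete_h n (Suc N)"
proof (rule poly_mapping_eqI)
  fix m :: "nat \<Rightarrow>\<^sub>0 nat"
  show "Poly_Mapping.lookup (complete_h (Suc n) (Suc N)) m
    = Poly_Mapping.lookup (complete_h (Suc n) N + vpoly N * complete_h n (Suc N)) m"
  proof (cases "Poly_Mapping.lookup m N = 0")
    case True
    then have "Poly_Mapping.keys m \<subseteq> {..<Suc N} \<longleftrightarrow> Poly_Mapping.keys m \<subseteq> {..<N}"
      by (auto simp: less_Suc_eq in_keys_iff subset_iff) (metis less_irrefl)
    then show ?thesis
      using True by (simp add: lookup_add lookup_vpoly_mult lookup_complete_h)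
  next
    case False
    define t where "t = m - Poly_Mapping.single N 1"
    have m: "m = t + Poly_Mapping.single N 1"
      using False unfolding t_def
      by (intro poly_mapping_eqI) (auto simp: lookup_add lookup_minus lookup_monomial_single)
    have "\<not> Poly_Mapping.keys m \<subseteq> {..<N}"
      using False by (metis in_keys_iff lessThan_iff less_irrefl subsetD)
    moreover have "Poly_Mapping.keys m \<subseteq> {..<Suc N} \<longleftrightarrow> Poly_Mapping.keys t \<subseteq> {..<Suc N}"
      by (auto simp: m in_keys_iff lookup_add lookup_monomial_single subset_iff)
    moreover have "mdeg m = Suc (mdeg t)"
      by (simp add: m mdeg_add)
    ultimately show ?thesis
      using False by (simp add: lookup_add lookup_vpoly_mult lookup_complete_h t_def[symmetric, unfolded One_nat_def])
  qed
qed

lemma complete_h_no_variables: "complete_h (Suc n) 0 = 0"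
  by (rule poly_mapping_eqI) (simp add: lookup_complete_h keys_eq_empty)

unbundle fps_syntax

text \<open>
  The generating series of the complete homogeneous polynomials in \<open>N\<close> variables.
\<close>

definition h_series :: "nat \<Rightarrow> cmpoly fps" where
  "h_series N = Abs_fps (\<lambda>n. complete_h n N)"

text \<open>
  The factor \<open>1 - x\<^sub>i t\<close>; the generating series is the inverse of the product of these.
\<close>

definition lin_factor :: "nat \<Rightarrow> cmpoly fps" where
  "lin_factor i = 1 - fps_const (vpoly i) * fps_X"

lemma lin_factor_nth_0 [simp]: "lin_factor i $ 0 = 1"
  by (simp add: lin_factor_def)

lemma fps_mult_lin_factor_nth:
  "(f * lin_factor i) $ n = f $ n - (if n = 0 then 0 else vpoly i * f $ (n - 1))"
proof -
  have "f * lin_factor i = f - fps_const (vpoly i) * (f * fps_X)"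
    by (simp add: lin_factor_def algebra_simps)
  then show ?thesis by simp
qed

lemma h_series_Suc: "h_series (Suc N) * lin_factor N = h_series N"
proof (rule fps_ext)
  fix n
  show "(h_series (Suc N) * lin_factor N) $ n = h_series N $ n"
    by (cases n) (simp_all add: fps_mult_lin_factor_nth h_series_def complete_h_Suc_Suc)
qed

lemma h_series_mult_all: "h_series N * (\<Prod>i<N. lin_factor i) = 1"
proof (induction N)
  case 0
  show ?case
  proof (rule fps_ext)
    fix n
    show "(h_series 0 * (\<Prod>i<0. lin_factor i)) $ n = 1 $ n"
      by (cases n) (simp_all add: h_series_def complete_h_no_variables)
  qed
next
  case (Suc N)
  have "h_series (Suc N) * (\<Prod>i<Suc N. lin_factor i) = h_series (Suc N) * lin_factor N * (\<Prod>i<N. lin_factor i)"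
    by (simp add: mult_ac)
  then show ?case by (simp add: h_series_Suc Suc)
qed

lemma h_series_mult_others:
  assumes "k < N"
  shows "h_series N * (\<Prod>i\<in>{..<N} - {k}. lin_factor i) = Abs_fps (\<lambda>n. vpoly k ^ n)"
proof -
  let ?F = "h_series N * (\<Prod>i\<in>{..<N} - {k}. lin_factor i)"
  let ?G = "Abs_fps (\<lambda>n. vpoly k ^ n)"
  have F: "lin_factor k * ?F = 1"
    using h_series_mult_all[of N] assms by (simp add: prod.remove[of "{..<N}" k] mult_ac)
  have G: "?G * lin_factor k = 1"
  proof (rule fps_ext)
    fix n
    show "(?G * lin_factor k) $ n = 1 $ n"
      by (cases n) (simp_all add: fps_mult_lin_factor_nth)
  qed
  have "?F = ?G * lin_factor k * ?F"
    unfolding G by (rule mult_1_left[symmetric])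
  also have "\<dots> = ?G"
    unfolding mult.assoc F by (rule mult_1_right)
  finally show ?thesis .
qed

lemma prod_lin_factor_nth_eq_0:
  assumes "finite S" "n > card S"
  shows "(\<Prod>i\<in>S. lin_factor i) $ n = 0"
  using assms
proof (induction S arbitrary: n)
  case (insert x S)
  then show ?case
    by (simp add: mult.commute[of "lin_factor x"] fps_mult_lin_factor_nth)
qed simp

lemma prod_lin_factor_nth_0: "(\<Prod>i\<in>S. lin_factor i) $ 0 = 1"
  by (induction S rule: infinite_finite_induct)
    (simp_all add: mult.commute[of "lin_factor _"] fps_mult_lin_factor_nth)

lemma from_h_h_int: "from_h (h_int a) N = (if a < 0 then 0 else h_series N $ nat a)"
  by (simp add: h_int_def from_h_hvar h_series_def)

lemma sum_from_h_h_int_nth: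
  fixes q :: "cmpoly fps"
  assumes q: "\<And>n. n > L \<Longrightarrow> q $ n = 0"
  shows "(\<Sum>j\<le>L. from_h (h_int (int n - int L + int j)) N * q $ (L - j)) = (h_series N * q) $ n"
proof -
  let ?f = "\<lambda>j. from_h (h_int (int n - int j)) N * q $ j"
  have "(\<Sum>j\<le>L. from_h (h_int (int n - int L + int j)) N * q $ (L - j)) = (\<Sum>j\<le>L. ?f j)"
    by (rule sum.reindex_bij_witness[of _ "\<lambda>j. L - j" "\<lambda>j. L - j"]) (auto simp: of_nat_diff algebra_simps)
  also have "\<dots> = (\<Sum>j\<le>max L n. ?f j)"
    by (rule sum.mono_neutral_left) (auto simp: q)
  also have "\<dots> = (\<Sum>j\<le>n. ?f j)"
    by (rule sum.mono_neutral_right) (auto simp: from_h_h_int)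
  also have "\<dots> = (\<Sum>j\<le>n. h_series N $ (n - j) * q $ j)"
    by (intro sum.cong) (auto simp: from_h_h_int nat_diff_distrib of_nat_diff)
  also have "\<dots> = (h_series N * q) $ n"
    unfolding fps_mult_nth atLeast0AtMost
    by (rule sum.reindex_bij_witness[of _ "\<lambda>j. n - j" "\<lambda>j. n - j"]) auto
  finally show ?thesis .
qed

lemma from_h_jacobi_trudi:
  "from_h (jacobi_trudi l m) N = det (mat l l (\<lambda>(i, j). from_h (h_int (m i + int j)) N))"
proof -
  interpret comm_ring_hom "\<lambda>p. from_h p N" by (rule from_h_ring_hom)
  have "map_mat (\<lambda>p. from_h p N) (mat l l (\<lambda>(i, j). h_int (m i + int j)))
      = mat l l (\<lambda>(i, j). from_h (h_int (m i + int j)) N)"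
    by (rule eq_matI) auto
  then show ?thesis
    unfolding jacobi_trudi_def hom_det[symmetric] by simp
qed

text \<open>
  The row indices \<open>\<kappa>\<^sub>i - i\<close> of the Jacobi--Trudi determinant of the partition \<open>\<kappa>\<close>.
\<close>

definition partition_exponent :: "(nat \<Rightarrow> nat) \<Rightarrow> nat \<Rightarrow> int" where
  "partition_exponent \<kappa> i = int (\<kappa> i) - int i"

text \<open>
  The matrix \<open>(h(\<kappa>\<^sub>i - i + j))\<close> times the matrix \<open>E\<close> of the coefficients of
  \<open>\<Prod>\<^bsub>i\<noteq>k\<^esub> (1 - x\<^sub>i t)\<close> is the matrix of the powers of \<open>x\<^sub>k\<close>.  The empty partition, for which the
  first matrix is unitriangular, identifies \<open>det E\<close> as the denominator alternant.
\<close>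

lemma jacobi_trudi_mult_alternant:
  "from_h (jacobi_trudi N (partition_exponent \<kappa>)) N * alternant N (\<lambda>j. N - 1 - j)
    = alternant N (\<lambda>j. \<kappa> j + (N - 1 - j))"
proof -
  define q where "q k = (\<Prod>i\<in>{..<N} - {k}. lin_factor i)" for k
  define E where "E = mat N N (\<lambda>(j, k). q k $ (N - 1 - j))"
  define A where "A \<mu> = mat N N (\<lambda>(i, j). from_h (h_int (partition_exponent \<mu> i + int j)) N)" for \<mu>
  have q: "q k $ n = 0" if "k < N" "n > N - 1" for k n
    unfolding q_def using that by (intro prod_lin_factor_nth_eq_0) auto
  have det_A_E: "det (A \<mu>) * det E = alternant N (\<lambda>j. \<mu> j + (N - 1 - j))" for \<mu>
  proof -
    have "A \<mu> * E = transpose_mat (mat N N (\<lambda>(i, j). vpoly i ^ (\<mu> j + (N - 1 - j))))"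
    proof (rule eq_matI, goal_cases)
      case (1 i k)
      then have ik: "i < N" "k < N" by auto
      let ?n = "\<mu> i + (N - 1 - i)"
      have "(A \<mu> * E) $$ (i, k)
        = (\<Sum>j\<in>{0..<N}. from_h (h_int (partition_exponent \<mu> i + int j)) N * q k $ (N - 1 - j))"
        using ik by (simp add: A_def E_def scalar_prod_def)
      also have "{0..<N} = {..N - 1}"
        using ik by auto
      also have "(\<Sum>j\<in>{..N - 1}. from_h (h_int (partition_exponent \<mu> i + int j)) N * q k $ (N - 1 - j))
         = (\<Sum>j\<le>N - 1. from_h (h_int (int ?n - int (N - 1) + int j)) N * q k $ (N - 1 - j))"
        using ik by (simp add: partition_exponent_def of_nat_diff)
      also have "\<dots> = (h_series N * q k) $ ?n"
        using q[OF ik(2)] by (rule sum_from_h_h_int_nth)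
      also have "\<dots> = vpoly k ^ ?n"
        unfolding q_def h_series_mult_others[OF ik(2)] by simp
      finally show ?case using ik by simp
    qed (simp_all add: A_def E_def)
    moreover have "det (A \<mu> * E) = det (A \<mu>) * det E"
      by (rule det_mult[of _ N]) (simp_all add: A_def E_def)
    ultimately show ?thesis
      by (simp add: alternant_def det_transpose[of _ N])
  qed
  have "upper_triangular (A (\<lambda>_. 0))"
    by (auto simp: upper_triangular_def A_def partition_exponent_def from_h_h_int)
  moreover have "diag_mat (A (\<lambda>_. 0)) = replicate N 1"
    by (rule nth_equalityI) (auto simp: A_def diag_mat_def partition_exponent_def from_h_h_int h_series_def)
  ultimately have "det (A (\<lambda>_. 0)) = 1"
    by (subst det_upper_triangular[of _ N]) (auto simp: A_def)
  with det_A_E[of "\<lambda>_. 0"] have "det E = alternant N (\<lambda>j. N - 1 - j)"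
    by simp
  with det_A_E[of \<kappa>] show ?thesis
    by (simp add: from_h_jacobi_trudi A_def)
qed

text \<open>
  With fewer variables than nonempty rows, the coefficients of \<open>\<Prod>\<^sub>i (1 - x\<^sub>i t)\<close> form a nonzero vector in
  the kernel of the matrix.
\<close>

lemma jacobi_trudi_few_variables:
  assumes "N < l" "\<kappa> (l - 1) > 0"
  shows "from_h (jacobi_trudi l (partition_exponent \<kappa>)) N = 0"
proof -
  define q where "q = (\<Prod>i<N. lin_factor i)"
  define A where "A = mat l l (\<lambda>(i, j). from_h (h_int (partition_exponent \<kappa> i + int j)) N)"
  define v where "v = vec l (\<lambda>j. q $ (l - 1 - j))"
  have q: "q $ n = 0" if "n > l - 1" for n
    unfolding q_def using that assms by (intro prod_lin_factor_nth_eq_0) auto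
  have "A *\<^sub>v v = 0\<^sub>v l"
  proof (rule eq_vecI)
    fix i assume "i < dim_vec (0\<^sub>v l)"
    then have i: "i < l" by simp
    let ?n = "\<kappa> i + (l - 1 - i)"
    have "?n > 0" using assms i by (cases "i = l - 1") auto
    have "(A *\<^sub>v v) $ i = (\<Sum>j\<in>{0..<l}. from_h (h_int (partition_exponent \<kappa> i + int j)) N * q $ (l - 1 - j))"
      using i by (simp add: A_def v_def scalar_prod_def)
    also have "{0..<l} = {..l - 1}"
      using i by auto
    also have "(\<Sum>j\<in>{..l - 1}. from_h (h_int (partition_exponent \<kappa> i + int j)) N * q $ (l - 1 - j))
       = (\<Sum>j\<le>l - 1. from_h (h_int (int ?n - int (l - 1) + int j)) N * q $ (l - 1 - j))"
      using i by (simp add: partition_exponent_def of_nat_diff)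
    also have "\<dots> = (h_series N * q) $ ?n"
      using q by (rule sum_from_h_h_int_nth)
    also have "\<dots> = 0"
      unfolding q_def h_series_mult_all fps_one_nth by (rule if_not_P) (use \<open>?n > 0\<close> in linarith)
    finally show "(A *\<^sub>v v) $ i = 0\<^sub>v l $ i" using i by simp
  qed (simp add: A_def)
  moreover have "v $ (l - 1) = 1"
    using assms by (simp add: v_def q_def prod_lin_factor_nth_0)
  then have "v \<noteq> 0\<^sub>v l"
    using assms by auto
  moreover have "A \<in> carrier_mat l l" "v \<in> carrier_vec l"
    by (simp_all add: A_def v_def)
  ultimately have "det A = 0"
    using det_0_iff_vec_prod_zero by blast
  then show ?thesis
    by (simp add: from_h_jacobi_trudi A_def)
qed

lemma jacobi_trudi_Suc:
  assumes "m l = - int l"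
  shows "jacobi_trudi (Suc l) m = jacobi_trudi l m"
proof -
  let ?A = "mat (Suc l) (Suc l) (\<lambda>(i, j). h_int (m i + int j))"
  have "jacobi_trudi (Suc l) m = (\<Sum>j<Suc l. ?A $$ (l, j) * cofactor ?A l j)"
    unfolding jacobi_trudi_def by (rule laplace_expansion_row) auto
  also have "\<dots> = cofactor ?A l l"
    using assms by (simp add: h_int_def hvar_def)
  also have "mat_delete ?A l l = mat l l (\<lambda>(i, j). h_int (m i + int j))"
    by (rule eq_matI) (auto simp: mat_delete_def)
  then have "cofactor ?A l l = jacobi_trudi l m"
    by (simp add: cofactor_def jacobi_trudi_def)
  finally show ?thesis .
qed

lemma jacobi_trudi_partition_mono:
  assumes "\<forall>i\<ge>r. \<kappa> i = 0" "r \<le> l"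
  shows "jacobi_trudi l (partition_exponent \<kappa>) = jacobi_trudi r (partition_exponent \<kappa>)"
  using assms(2)
proof (induction l rule: dec_induct)
  case (step l)
  then show ?case
    using assms(1) by (simp add: jacobi_trudi_Suc partition_exponent_def)
qed simp

lemma vpoly_inj: "vpoly i = vpoly j \<Longrightarrow> i = j"
  using pdiff_vpoly[of i i] pdiff_vpoly[of i j] by (metis zero_neq_one)

lemma alternant_delta_nonzero: "alternant N (\<lambda>j. N - 1 - j) \<noteq> 0"
proof -
  let ?p = "\<lambda>j. if j < N then N - 1 - j else j"
  let ?W = "mat N N (\<lambda>(i, j). vpoly i ^ j)"
  have p: "?p permutes {0..<N}"
    by (rule bij_imp_permutes, rule bij_betw_byWitness[of _ ?p]) auto
  have "vandermonde N \<noteq> 0"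
    unfolding vandermonde_def using finite_pairs[of N]
    by (auto simp: prod_zero_iff dest: vpoly_inj)
  then have "det ?W \<noteq> 0"
    by (simp add: vandermonde_eq_det)
  have "alternant N (\<lambda>j. N - 1 - j) = det (transpose_mat (mat N N (\<lambda>(i, j). vpoly i ^ (N - 1 - j))))"
    unfolding alternant_def by (rule det_transpose[symmetric, of _ N]) auto
  also have "transpose_mat (mat N N (\<lambda>(i, j). vpoly i ^ (N - 1 - j)))
      = mat N N (\<lambda>(i, j). transpose_mat ?W $$ (?p i, j))"
    by (rule eq_matI) auto
  also have "det \<dots> = signof ?p * det (transpose_mat ?W)"
    by (rule det_permute_rows[OF _ p]) auto
  also have "det (transpose_mat ?W) = det ?W"
    by (rule det_transpose[of _ N]) auto
  finally show ?thesis
    using \<open>det ?W \<noteq> 0\<close> by (simp add: sign_def)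
qed

lemma schur_eq_jacobi_trudi:
  assumes "\<forall>i\<ge>l. row_length \<nu> i = 0"
  shows "schur \<nu> = from_h (jacobi_trudi l (partition_exponent (row_length \<nu>)))"
proof
  fix N
  let ?P = "\<lambda>r. \<forall>i\<ge>r. row_length \<nu> i = 0"
  define r where "r = (LEAST r. ?P r)"
  have r: "?P r" unfolding r_def using assms by (rule LeastI[of ?P])
  have "r \<le> l" unfolding r_def using assms by (rule Least_le[of ?P])
  with r have l: "jacobi_trudi l (partition_exponent (row_length \<nu>)) = jacobi_trudi r (partition_exponent (row_length \<nu>))"
    by (rule jacobi_trudi_partition_mono)
  show "schur \<nu> N = from_h (jacobi_trudi l (partition_exponent (row_length \<nu>))) N"
  proof (cases "r \<le> N")
    case True
    define f where "f = from_h (jacobi_trudi l (partition_exponent (row_length \<nu>))) N"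
    have "f = from_h (jacobi_trudi N (partition_exponent (row_length \<nu>))) N"
      by (simp add: f_def l jacobi_trudi_partition_mono[OF r True])
    then have f: "f * alternant N (\<lambda>j. N - 1 - j) = alternant N (\<lambda>j. row_length \<nu> j + (N - 1 - j))"
      by (simp only: jacobi_trudi_mult_alternant)
    have "schur \<nu> N = (THE s. s * alternant N (\<lambda>j. N - 1 - j) = alternant N (\<lambda>j. row_length \<nu> j + (N - 1 - j)))"
      unfolding schur_def by (rule if_P) (use True r in auto)
    also have "\<dots> = f"
    proof (rule the_equality)
      fix s
      assume "s * alternant N (\<lambda>j. N - 1 - j) = alternant N (\<lambda>j. row_length \<nu> j + (N - 1 - j))"
      then show "s = f"
        using f alternant_delta_nonzero[of N] by (metis mult_right_cancel)
    qed (rule f)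
    finally show ?thesis by (simp add: f_def)
  next
    case False
    then have "N < r" "r - 1 < r" by auto
    then have "\<not> ?P N" "\<not> ?P (r - 1)"
      unfolding r_def by (blast dest: not_less_Least)+
    then have "row_length \<nu> (r - 1) > 0"
      using r by (metis One_nat_def Suc_pred gr0I le_antisym not_less_eq_eq not_le)
    then show ?thesis using \<open>\<not> ?P N\<close>
      unfolding schur_def using False by (subst if_not_P) (auto simp: l jacobi_trudi_few_variables)
  qed
qed

section \<open>Polynomials in the complete functions are symmetric functions\<close>

lemma lin_ext_cpoly: "\<phi> 0 = 1 \<Longrightarrow> lin_ext \<phi> (cpoly c) = cpoly c"
  by (simp add: cpoly_def)

lemma from_h_hom_eqI:
  assumes \<phi>: "\<phi> 0 = 1" "\<And>m m'. \<phi> (m + m') = \<phi> m * \<phi> m'"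
    and h: "\<And>n. lin_ext \<phi> (complete_h n N) = complete_h n N'"
  shows "lin_ext \<phi> (from_h p N) = from_h p N'"
proof -
  interpret comm_ring_hom "lin_ext \<phi>" using \<phi> by (rule lin_ext_ring_hom)
  show ?thesis
    by (simp add: from_h_eq_lin_ext lin_ext_def[of "h_monomial _"] h_monomial_def
        hom_distribs lin_ext_cpoly[of \<phi>, OF \<phi>(1)] h)
qed

text \<open>
  The substitution \<open>x\<^sub>i = 0\<close> for \<open>i \<ge> N\<close>, on monomials.
\<close>

definition restrict_vars :: "nat \<Rightarrow> (nat \<Rightarrow>\<^sub>0 nat) \<Rightarrow> cmpoly" where
  "restrict_vars N m = (if Poly_Mapping.keys m \<subseteq> {..<N} then Poly_Mapping.single m 1 else 0)"

lemma restrict_vars_add: "restrict_vars N (m + m') = restrict_vars N m * restrict_vars N m'"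
proof -
  have "Poly_Mapping.keys (m + m') \<subseteq> {..<N} \<longleftrightarrow> Poly_Mapping.keys m \<subseteq> {..<N} \<and> Poly_Mapping.keys m' \<subseteq> {..<N}"
    by (auto simp: in_keys_iff lookup_add subset_iff)
  then show ?thesis by (simp add: restrict_vars_def mult_single)
qed

lemma lookup_restrict_vars:
  "Poly_Mapping.lookup (lin_ext (restrict_vars N) p) m
    = (if Poly_Mapping.keys m \<subseteq> {..<N} then Poly_Mapping.lookup p m else 0)"
  by (induction p rule: cmpoly_induct)
    (auto simp: restrict_vars_def cpoly_def mult_single lookup_single when_def lin_ext_add lookup_add)

lemma restrict_from_h:
  assumes "N \<le> N'"
  shows "lin_ext (restrict_vars N) (from_h p N') = from_h p N"
proof (rule from_h_hom_eqI)
  fix n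
  show "lin_ext (restrict_vars N) (complete_h n N') = complete_h n N"
    using assms by (intro poly_mapping_eqI) (auto simp: lookup_restrict_vars lookup_complete_h subset_iff)
qed (simp_all add: restrict_vars_add, simp add: restrict_vars_def)

text \<open>
  The renaming of variables by \<open>\<pi>\<close>, on monomials.
\<close>

definition rename_vars :: "(nat \<Rightarrow> nat) \<Rightarrow> (nat \<Rightarrow>\<^sub>0 nat) \<Rightarrow> cmpoly" where
  "rename_vars \<pi> m = Poly_Mapping.single (Poly_Mapping.map_key (Hilbert_Choice.inv \<pi>) m) 1"

lemma map_key_inv_eq_iff:
  fixes \<pi> :: "nat \<Rightarrow> nat" and t m :: "nat \<Rightarrow>\<^sub>0 nat"
  assumes "bij \<pi>"
  shows "Poly_Mapping.map_key (Hilbert_Choice.inv \<pi>) t = m \<longleftrightarrow> t = Poly_Mapping.map_key \<pi> m"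
proof -
  have inj: "inj \<pi>" "inj (Hilbert_Choice.inv \<pi>)"
    using assms by (auto simp: bij_is_inj bij_imp_bij_inv)
  have "Poly_Mapping.map_key \<pi> (Poly_Mapping.map_key (Hilbert_Choice.inv \<pi>) t) = t"
    "Poly_Mapping.map_key (Hilbert_Choice.inv \<pi>) (Poly_Mapping.map_key \<pi> m) = m" for t m :: "nat \<Rightarrow>\<^sub>0 nat"
    using assms inj
    by (simp_all add: map_key_compose bij_is_surj surj_iff[symmetric] map_key_id[unfolded id_def]
        inv_o_cancel surj_f_inv_f o_def)
  then show ?thesis by metis
qed

lemma lookup_rename_vars:
  assumes "bij \<pi>"
  shows "Poly_Mapping.lookup (lin_ext (rename_vars \<pi>) p) m = Poly_Mapping.lookup p (Poly_Mapping.map_key \<pi> m)"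
  by (induction p rule: cmpoly_induct)
    (auto simp: rename_vars_def cpoly_def mult_single lookup_single when_def lin_ext_add lookup_add
       map_key_inv_eq_iff[OF assms])

lemma mdeg_map_key:
  assumes "bij \<pi>"
  shows "mdeg (Poly_Mapping.map_key \<pi> m) = mdeg m"
proof -
  have inj: "inj \<pi>" using assms by (rule bij_is_inj)
  have "mdeg (Poly_Mapping.map_key \<pi> m) = (\<Sum>i\<in>\<pi> -` Poly_Mapping.keys m. Poly_Mapping.lookup m (\<pi> i))"
    by (simp add: mdeg_def keys_map_key[OF inj] map_key.rep_eq inj)
  also have "\<dots> = (\<Sum>i\<in>\<pi> ` (\<pi> -` Poly_Mapping.keys m). Poly_Mapping.lookup m i)"
    using sum.reindex[OF inj_on_subset[OF inj subset_UNIV], of "Poly_Mapping.lookup m" "\<pi> -` Poly_Mapping.keys m"]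
    by (simp add: o_def)
  also have "\<pi> ` (\<pi> -` Poly_Mapping.keys m) = Poly_Mapping.keys m"
    using assms by (simp add: bij_is_surj surj_image_vimage_eq)
  finally show ?thesis by (simp add: mdeg_def)
qed

lemma rename_from_h:
  assumes "\<pi> permutes {..<N}"
  shows "lin_ext (rename_vars \<pi>) (from_h p N) = from_h p N"
proof (rule from_h_hom_eqI)
  have bij: "bij \<pi>" using assms by (rule permutes_bij)
  then have inj: "inj (Hilbert_Choice.inv \<pi>)" by (simp add: bij_imp_bij_inv bij_is_inj)
  show "rename_vars \<pi> 0 = 1"
    by (simp add: rename_vars_def map_key_zero[OF inj])
  show "rename_vars \<pi> (m + m') = rename_vars \<pi> m * rename_vars \<pi> m'" for m m'
    by (simp add: rename_vars_def mult_single map_key_plus[OF inj])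
  have "\<pi> -` A \<subseteq> {..<N} \<longleftrightarrow> A \<subseteq> {..<N}" for A
    using permutes_in_image[OF assms] permutes_surj[OF assms] by (auto simp: subset_iff) (metis surjD)
  then show "lin_ext (rename_vars \<pi>) (complete_h n N) = complete_h n N" for n
    by (intro poly_mapping_eqI)
      (simp add: lookup_rename_vars[OF bij] lookup_complete_h mdeg_map_key[OF bij] keys_map_key bij_is_inj[OF bij])
qed

text \<open>
  The degrees of the polynomials in the sequence have a common bound.
\<close>

definition bounded_degree :: "(nat \<Rightarrow> cmpoly) \<Rightarrow> bool" where
  "bounded_degree f \<longleftrightarrow> (\<exists>d. \<forall>N. \<forall>m\<in>Poly_Mapping.keys (f N). mdeg m \<le> d)"

lemma bounded_degree_add:
  assumes "bounded_degree f" "bounded_degree g"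
  shows "bounded_degree (f + g)"
proof -
  obtain d e where "\<forall>N. \<forall>m\<in>Poly_Mapping.keys (f N). mdeg m \<le> d" "\<forall>N. \<forall>m\<in>Poly_Mapping.keys (g N). mdeg m \<le> e"
    using assms unfolding bounded_degree_def by blast
  then have "\<forall>N. \<forall>m\<in>Poly_Mapping.keys ((f + g) N). mdeg m \<le> d + e"
    using Poly_Mapping.keys_add[of "f _" "g _"] by (fastforce dest: subsetD)
  then show ?thesis unfolding bounded_degree_def by blast
qed

lemma bounded_degree_mult:
  assumes "bounded_degree f" "bounded_degree g"
  shows "bounded_degree (f * g)"
proof -
  obtain d e where de: "\<forall>N. \<forall>m\<in>Poly_Mapping.keys (f N). mdeg m \<le> d" "\<forall>N. \<forall>m\<in>Poly_Mapping.keys (g N). mdeg m \<le> e"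
    using assms unfolding bounded_degree_def by blast
  have "mdeg m \<le> d + e" if "m \<in> Poly_Mapping.keys ((f * g) N)" for N m
  proof -
    have "m \<in> {a + b |a b. a \<in> Poly_Mapping.keys (f N) \<and> b \<in> Poly_Mapping.keys (g N)}"
      using that Poly_Mapping.keys_mult[of "f N" "g N"] by auto
    then show ?thesis
      using de by (auto simp: mdeg_add add_mono)
  qed
  then show ?thesis unfolding bounded_degree_def by blast
qed

lemma bounded_degree_from_h: "bounded_degree (from_h p)"
proof (induction p rule: cmpoly_induct)
  case (monomial m c)
  have "bounded_degree (from_h (cpoly c))"
    unfolding bounded_degree_def
    by (auto simp: from_h_eq_lin_ext lin_ext_cpoly[of "h_monomial _", OF h_monomial_0] intro!: exI[of _ 0])
      (auto simp: cpoly_def split: if_splits)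
  moreover have "bounded_degree (from_h (vpoly i))" for i
  proof -
    have "from_h (vpoly i) = complete_h (Suc i)"
      using from_h_hvar[of "Suc i"] by (simp add: hvar_def)
    then show ?thesis
      by (auto simp: bounded_degree_def in_keys_iff lookup_complete_h intro!: exI[of _ "Suc i"] split: if_splits)
  qed
  moreover have one: "bounded_degree (from_h 1)"
    by (auto simp: bounded_degree_def)
  ultimately have "bounded_degree (from_h (vpoly i ^ k))" for i k
    by (induction k) (simp_all add: from_h_mult bounded_degree_mult del: from_h_1)
  with one have "bounded_degree (from_h (\<Prod>i\<in>A. vpoly i ^ k i))" for A k
    by (induction A rule: infinite_finite_induct) (simp_all add: from_h_mult bounded_degree_mult del: from_h_1)
  then have "bounded_degree (from_h (Poly_Mapping.single m 1))"
    by (simp only: monomial_as_prod)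
  moreover have "Poly_Mapping.single m c = cpoly c * Poly_Mapping.single m 1"
    by (simp add: cpoly_def mult_single)
  ultimately show ?case
    using \<open>bounded_degree (from_h (cpoly c))\<close> by (simp only: from_h_mult bounded_degree_mult)
qed (simp only: from_h_add bounded_degree_add)

lemma from_h_in_SymC: "from_h p \<in> SymC"
proof -
  have restr: "(if Poly_Mapping.keys m \<subseteq> {..<N} then Poly_Mapping.lookup (from_h p N') m else 0)
      = Poly_Mapping.lookup (from_h p N) m" if "N \<le> N'" for N N' m
    using restrict_from_h[OF that, of p] by (metis lookup_restrict_vars)
  have "from_h p N \<in> sympoly N" for N
  proof -
    have "\<forall>m\<in>Poly_Mapping.keys (from_h p N). Poly_Mapping.keys m \<subseteq> {..<N}"
      using restr[of N N] by (metis in_keys_iff order_refl)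
    moreover have "Poly_Mapping.lookup (from_h p N) (Poly_Mapping.map_key \<pi> m) = Poly_Mapping.lookup (from_h p N) m"
      if "\<pi> permutes {..<N}" for \<pi> m
      using rename_from_h[OF that, of p] lookup_rename_vars[OF permutes_bij[OF that]] by metis
    ultimately show ?thesis by (simp add: sympoly_def)
  qed
  moreover have "Poly_Mapping.lookup (from_h p (Suc N)) m = Poly_Mapping.lookup (from_h p N) m"
    if "Poly_Mapping.keys m \<subseteq> {..<N}" for N m
    using restr[of N "Suc N" m] that by simp
  ultimately show ?thesis
    using bounded_degree_from_h[of p] by (simp add: SymC_def bounded_degree_def)
qed

section \<open>Young diagrams\<close>

lemma young_diagram_mem_iff:
  assumes "young_diagram \<nu>"
  shows "(i, j) \<in> \<nu> \<longleftrightarrow> j < row_length \<nu> i"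
proof -
  let ?R = "{j. (i, j) \<in> \<nu>}"
  have "?R \<subseteq> snd ` \<nu>" by force
  then have fin: "finite ?R"
    using assms finite_subset unfolding young_diagram_def by blast
  have down: "j' \<in> ?R" if "j \<in> ?R" "j' \<le> j" for j j'
    using that assms unfolding young_diagram_def by blast
  have "?R = {..<card ?R}"
  proof (cases "?R = {}")
    case False
    have "?R \<subseteq> {..Max ?R}"
      using fin by (meson Max_ge atMost_iff subsetI)
    moreover have "{..Max ?R} \<subseteq> ?R"
      using down[OF Max_in[OF fin False]] by blast
    ultimately have "?R = {..Max ?R}" by (rule equalityI)
    then have "?R = {..<Suc (Max ?R)}" by (simp add: lessThan_Suc_atMost)
    then show ?thesis by (metis card_lessThan)
  qed simp
  then show ?thesis unfolding row_length_def by blast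
qed

lemma row_length_antimono:
  assumes "young_diagram \<nu>" "i \<le> i'"
  shows "row_length \<nu> i' \<le> row_length \<nu> i"
proof (rule ccontr)
  assume "\<not> ?thesis"
  then have "(i', row_length \<nu> i) \<in> \<nu>" by (simp add: young_diagram_mem_iff[OF assms(1)])
  then have "(i, row_length \<nu> i) \<in> \<nu>"
    using assms unfolding young_diagram_def by blast
  then show False by (simp add: young_diagram_mem_iff[OF assms(1)])
qed

lemma card_young_diagram:
  assumes "young_diagram \<nu>" "\<forall>i\<ge>l. row_length \<nu> i = 0"
  shows "card \<nu> = (\<Sum>i<l. row_length \<nu> i)"
proof -
  have "\<nu> = Sigma {..<l} (\<lambda>i. {..<row_length \<nu> i})"
    using assms(2) young_diagram_mem_iff[OF assms(1)] by (auto simp: not_less) (metis not_less not_less0)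
  then have "card \<nu> = card (Sigma {..<l} (\<lambda>i. {..<row_length \<nu> i}))" by simp
  then show ?thesis by simp
qed

lemma corners_eq:
  assumes \<nu>: "young_diagram \<nu>" and l: "\<forall>i\<ge>l. row_length \<nu> i = 0"
  shows "corners \<nu> = (\<lambda>i. (i, row_length \<nu> i - 1)) ` {i. i < l \<and> row_length \<nu> (Suc i) < row_length \<nu> i}"
    (is "_ = ?f ` ?I")
proof (intro equalityI subsetI)
  note mem = young_diagram_mem_iff[OF \<nu>]
  fix b assume "b \<in> corners \<nu>"
  then obtain i j where b: "b = (i, j)" "(i, j) \<in> \<nu>" and y: "young_diagram (\<nu> - {(i, j)})"
    unfolding corners_def by (cases b) auto
  have closed: "(i', j') \<in> \<nu> - {(i, j)}" if "(i1, j1) \<in> \<nu> - {(i, j)}" "i' \<le> i1" "j' \<le> j1" for i1 j1 i' j'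
    using that y unfolding young_diagram_def by blast
  have "(i, Suc j) \<notin> \<nu>" using closed[of i "Suc j" i j] by auto
  then have j: "row_length \<nu> i = Suc j" using b(2) by (simp add: mem)
  have "(Suc i, j) \<notin> \<nu>" using closed[of "Suc i" j i j] by auto
  then have "row_length \<nu> (Suc i) < row_length \<nu> i" using j by (simp add: mem)
  moreover have "i < l" using l j by (metis Zero_not_Suc not_le)
  ultimately show "b \<in> ?f ` ?I" using j b(1) by force
next
  note mem = young_diagram_mem_iff[OF \<nu>]
  fix b assume "b \<in> ?f ` ?I"
  then obtain i where b: "b = (i, row_length \<nu> i - 1)" and i: "row_length \<nu> (Suc i) < row_length \<nu> i" by auto
  have "young_diagram (\<nu> - {b})"
    unfolding young_diagram_def
  proof (intro conjI allI impI)
    show "finite (\<nu> - {b})" using \<nu> by (simp add: young_diagram_def)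
    fix i1 j1 i' j' assume a: "(i1, j1) \<in> \<nu> - {b}" "i' \<le> i1" "j' \<le> j1"
    then have "(i', j') \<in> \<nu>" using \<nu> unfolding young_diagram_def by blast
    moreover have "(i', j') \<noteq> b"
    proof
      assume eq: "(i', j') = b"
      have "j1 < row_length \<nu> i1" using a(1) by (simp add: mem)
      moreover have "row_length \<nu> i1 \<le> row_length \<nu> i" using row_length_antimono[OF \<nu>] a(2) eq b by auto
      ultimately have "j1 = row_length \<nu> i - 1" "row_length \<nu> i1 = row_length \<nu> i"
        using a(3) eq b by auto
      then have "i1 \<noteq> i" using a(1) b by auto
      then have "Suc i \<le> i1" using a(2) eq b by auto
      then show False using row_length_antimono[OF \<nu>] i \<open>row_length \<nu> i1 = row_length \<nu> i\<close> by fastforce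
    qed
    ultimately show "(i', j') \<in> \<nu> - {b}" by simp
  qed
  moreover have "b \<in> \<nu>" using b i by (simp add: mem)
  ultimately show "b \<in> corners \<nu>" by (simp add: corners_def)
qed

lemma row_length_remove_corner:
  assumes "young_diagram \<nu>" "0 < row_length \<nu> i"
  shows "row_length (\<nu> - {(i, row_length \<nu> i - 1)}) = (row_length \<nu>)(i := row_length \<nu> i - 1)"
proof
  fix k
  have "{j. (k, j) \<in> \<nu> - {(i, row_length \<nu> i - 1)}} = (if k = i then {..<row_length \<nu> i - 1} else {..<row_length \<nu> k})"
    using assms(2) by (auto simp: young_diagram_mem_iff[OF assms(1)])
  then show "row_length (\<nu> - {(i, row_length \<nu> i - 1)}) k = ((row_length \<nu>)(i := row_length \<nu> i - 1)) k"
    unfolding row_length_def[of "_ - _"] by simp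
qed

lemma diagram_of_row_lengths:
  assumes "\<And>i. \<kappa> (Suc i) \<le> \<kappa> i" "\<forall>i\<ge>l. \<kappa> i = 0"
  shows "young_diagram {(i, j). j < \<kappa> i}" "row_length {(i, j). j < \<kappa> i} = \<kappa>"
proof -
  have anti: "\<kappa> i' \<le> \<kappa> i" if "i \<le> i'" for i i'
    using lift_Suc_antimono_le[of \<kappa>] assms(1) that by blast
  have "{(i, j). j < \<kappa> i} \<subseteq> {..<l} \<times> {..<\<kappa> 0}"
    using assms(2) anti[of 0] by (auto simp: not_le[symmetric]) (meson le_trans not_le zero_le)+
  then have "finite {(i, j). j < \<kappa> i}" by (rule finite_subset) simp
  then show "young_diagram {(i, j). j < \<kappa> i}"
    unfolding young_diagram_def using anti by (fastforce dest: less_le_trans)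
  show "row_length {(i, j). j < \<kappa> i} = \<kappa>"
    by (simp add: fun_eq_iff row_length_def)
qed

lemma jacobi_trudi_cong:
  "(\<And>i. i < l \<Longrightarrow> m i = m' i) \<Longrightarrow> jacobi_trudi l m = jacobi_trudi l m'"
  unfolding jacobi_trudi_def by (intro arg_cong[of _ _ det] eq_matI) auto

lemma jacobi_trudi_zero_row:
  assumes "i < l" "m i \<le> - int l"
  shows "jacobi_trudi l m = 0"
  unfolding jacobi_trudi_eq_sum
proof (intro sum.neutral ballI)
  fix \<tau> assume "\<tau> \<in> perms l"
  then have "\<tau> i < l" using permutes_in_image[of \<tau> "{0..<l}" i] assms(1) by simp
  then have "h_int (m i + int (\<tau> i)) = 0" using assms(2) by (simp add: h_int_def)
  then have "(\<Prod>k<l. h_int (m k + int (\<tau> k))) = 0" using assms(1) by (intro prod_zero) auto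
  then show "signof \<tau> * (\<Prod>k<l. h_int (m k + int (\<tau> k))) = 0" by simp
qed

lemma jacobi_trudi_equal_rows:
  assumes "i \<noteq> k" "i < l" "k < l" "m i = m k"
  shows "jacobi_trudi l m = 0"
  unfolding jacobi_trudi_def
  by (rule det_identical_rows[of _ l i k]) (use assms in \<open>auto intro!: eq_vecI\<close>)

lemma jacobi_trudi_permute:
  assumes "\<pi> permutes {0..<l}"
  shows "jacobi_trudi l (m \<circ> \<pi>) = signof \<pi> * jacobi_trudi l m"
proof -
  let ?A = "mat l l (\<lambda>(i, j). h_int (m i + int j))"
  have "mat l l (\<lambda>(i, j). h_int ((m \<circ> \<pi>) i + int j)) = mat l l (\<lambda>(i, j). ?A $$ (\<pi> i, j))"
    using permutes_in_image[OF assms] by (intro eq_matI) auto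
  then show ?thesis
    unfolding jacobi_trudi_def using det_permute_rows[OF _ assms, of ?A] by simp
qed

lemma sorting_permutation:
  fixes m :: "nat \<Rightarrow> 'a::linorder"
  assumes "inj_on m {..<l}"
  obtains \<pi> where "\<pi> permutes {0..<l}" "\<And>i j. i < j \<Longrightarrow> j < l \<Longrightarrow> m (\<pi> j) < m (\<pi> i)"
proof -
  define xs where "xs = rev (sorted_list_of_set (m ` {..<l}))"
  have len: "length xs = l" using assms by (simp add: xs_def card_image)
  have set: "set xs = m ` {..<l}" by (simp add: xs_def)
  have "distinct xs" by (simp add: xs_def)
  define \<sigma> where "\<sigma> i = inv_into {..<l} m (xs ! i)" for i
  have "bij_betw (inv_into {..<l} m \<circ> (!) xs) {..<l} {..<l}"
    using \<open>distinct xs\<close> len set assms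
    by (intro bij_betw_trans[of _ _ "set xs"] bij_betw_nth)
       (auto intro!: bij_betw_inv_into inj_on_imp_bij_betw)
  then have bij: "bij_betw \<sigma> {..<l} {..<l}"
    by (simp only: \<sigma>_def[abs_def] o_def)
  define \<pi> where "\<pi> i = (if i < l then \<sigma> i else i)" for i
  have "bij_betw \<pi> {..<l} {..<l}"
    using bij by (subst bij_betw_cong[of _ \<pi> \<sigma>]) (simp_all add: \<pi>_def)
  then have "\<pi> permutes {..<l}"
    by (rule bij_imp_permutes) (simp add: \<pi>_def)
  moreover have m: "m (\<pi> i) = xs ! i" if "i < l" for i
    using that len set by (simp add: \<pi>_def \<sigma>_def f_inv_into_f flip: set)
  moreover have "xs ! j < xs ! i" if "i < j" "j < l" for i j
  proof -
    have "sorted_wrt (>) xs" by (simp add: xs_def sorted_wrt_rev)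
    then show ?thesis using that len by (simp add: sorted_wrt_iff_nth_less)
  qed
  ultimately show ?thesis by (intro that[of \<pi>]) (simp_all add: atLeast0LessThan)
qed

section \<open>Comparison of the two operators\<close>

lemma sum_mult_permuted_less:
  fixes \<tau> :: "nat \<Rightarrow> nat"
  assumes "\<tau> permutes {..<l}" "\<tau> \<noteq> id"
  shows "(\<Sum>i<l. int i * int (\<tau> i)) < (\<Sum>i<l. int i * int i)"
proof -
  obtain i where "\<tau> i \<noteq> i" using assms(2) by (auto simp: fun_eq_iff)
  then have "i < l" using assms(1) by (auto simp: permutes_def)
  have "(\<Sum>i<l. int (\<tau> i) * int (\<tau> i)) = (\<Sum>i<l. int i * int i)"
    using sum.permute[OF assms(1), of "\<lambda>i. int i * int i"] by (simp add: o_def)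
  moreover have "(\<Sum>i<l. (int i - int (\<tau> i)) * (int i - int (\<tau> i))) > 0"
    using \<open>i < l\<close> \<open>\<tau> i \<noteq> i\<close> by (intro sum_pos2[of _ i]) (auto simp: zero_less_mult_iff)
  moreover have "(\<Sum>i<l. (int i - int (\<tau> i)) * (int i - int (\<tau> i)))
     = (\<Sum>i<l. int i * int i) + (\<Sum>i<l. int (\<tau> i) * int (\<tau> i)) - 2 * (\<Sum>i<l. int i * int (\<tau> i))"
    by (simp add: algebra_simps sum.distrib sum_subtractf sum_distrib_left)
  ultimately show ?thesis by linarith
qed

text \<open>
  A Laguerre operator with parameters \<open>z\<close> and \<open>z'\<close>, held fixed while the polynomials on which it agrees
  with the differential operator are collected.
\<close>

locale laguerre =
  fixes z z' :: complex and D :: "(nat \<Rightarrow> cmpoly) \<Rightarrow> nat \<Rightarrow> cmpoly"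
  assumes laguerre: "is_laguerre_operator z z' D"
begin

text \<open>
  The two operators agree on \<open>p\<close>.
\<close>

definition intertwined :: "cmpoly \<Rightarrow> bool" where
  "intertwined p \<longleftrightarrow> D (from_h p) = from_h (laguerre_diffop z z' p)"

lemma intertwined_add: "intertwined p \<Longrightarrow> intertwined q \<Longrightarrow> intertwined (p + q)"
  using laguerre from_h_in_SymC
  by (auto simp: intertwined_def is_laguerre_operator_def from_h_add laguerre_diffop_add)

lemma intertwined_scale: "intertwined p \<Longrightarrow> intertwined (cpoly c * p)"
  using laguerre from_h_in_SymC
  by (auto simp: intertwined_def is_laguerre_operator_def from_h_scale laguerre_diffop_scale)

lemma intertwined_0: "intertwined 0"
proof -
  have "D (sf_scale 0 (from_h 0)) = sf_scale 0 (D (from_h 0))"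
    using laguerre from_h_in_SymC unfolding is_laguerre_operator_def by blast
  moreover have "laguerre_diffop z z' 0 = 0"
    using laguerre_diffop_scale[of z z' 0 0] by simp
  moreover have "sf_scale 0 f = 0" for f
    by (simp add: sf_scale_def fun_eq_iff)
  ultimately show ?thesis by (simp add: intertwined_def)
qed

lemma intertwined_signof: "intertwined p \<Longrightarrow> intertwined (signof \<tau> * p)"
  using intertwined_scale[of p "of_int (sign \<tau>)"] by (simp only: cpoly_of_int)

lemma intertwined_sum: "(\<And>a. a \<in> A \<Longrightarrow> intertwined (f a)) \<Longrightarrow> intertwined (\<Sum>a\<in>A. f a)"
  by (induction A rule: infinite_finite_induct) (simp_all add: intertwined_0 intertwined_add)

lemma intertwined_diff: "intertwined p \<Longrightarrow> intertwined q \<Longrightarrow> intertwined (p - q)"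
  using intertwined_add[of p "- q"] intertwined_scale[of q "- 1"] by (simp add: cpoly_minus)

text \<open>
  For every row \<open>i\<close> that does not end in a corner the determinant with lowered row \<open>i\<close> has two equal rows,
  or a zero row if \<open>i\<close> is the last one.  Hence the sum over corners is a sum over all rows.
\<close>

lemma intertwined_young_diagram:
  assumes \<nu>: "young_diagram \<nu>" and l: "\<forall>i\<ge>l. row_length \<nu> i = 0"
  shows "intertwined (jacobi_trudi l (partition_exponent (row_length \<nu>)))"
proof -
  define \<kappa> where "\<kappa> = row_length \<nu>"
  define m where "m = partition_exponent \<kappa>"
  let ?I = "{i. i < l \<and> \<kappa> (Suc i) < \<kappa> i}"
  let ?c = "\<lambda>i. (z + of_int (m i) - 1) * (z' + of_int (m i) - 1)"
  let ?J = "\<lambda>i. jacobi_trudi l (m(i := m i - 1))"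
  have schur: "schur \<nu> = from_h (jacobi_trudi l m)"
    unfolding m_def \<kappa>_def by (rule schur_eq_jacobi_trudi[OF l])
  have removed: "schur (\<nu> - {(i, \<kappa> i - 1)}) = from_h (?J i)"
    and content: "content (i, \<kappa> i - 1) = of_int (m i) - 1" if "i \<in> ?I" for i
  proof -
    have "\<kappa> i > 0" using that by auto
    then have row: "row_length (\<nu> - {(i, \<kappa> i - 1)}) = \<kappa>(i := \<kappa> i - 1)"
      unfolding \<kappa>_def by (intro row_length_remove_corner[OF \<nu>])
    have "schur (\<nu> - {(i, \<kappa> i - 1)}) = from_h (jacobi_trudi l (partition_exponent (\<kappa>(i := \<kappa> i - 1))))"
    proof -
      have "\<forall>k\<ge>l. row_length (\<nu> - {(i, \<kappa> i - 1)}) k = 0"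
        unfolding row using l by (simp add: \<kappa>_def)
      from schur_eq_jacobi_trudi[OF this] show ?thesis by (simp only: row)
    qed
    also have "partition_exponent (\<kappa>(i := \<kappa> i - 1)) = m(i := m i - 1)"
      using \<open>\<kappa> i > 0\<close> by (auto simp: fun_eq_iff m_def partition_exponent_def)
    finally show "schur (\<nu> - {(i, \<kappa> i - 1)}) = from_h (?J i)" .
    show "content (i, \<kappa> i - 1) = of_int (m i) - 1"
      using \<open>\<kappa> i > 0\<close> by (simp add: content_def m_def partition_exponent_def of_nat_diff)
  qed
  have vanish: "?J i = 0" if "i < l" "i \<notin> ?I" for i
  proof -
    have eq: "\<kappa> (Suc i) = \<kappa> i"
      using that row_length_antimono[OF \<nu>, of i "Suc i"] by (simp add: \<kappa>_def)
    show ?thesis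
    proof (cases "Suc i < l")
      case True
      then show ?thesis
        using eq by (intro jacobi_trudi_equal_rows[of i "Suc i"]) (auto simp: m_def partition_exponent_def)
    next
      case False
      then have "Suc i = l" using that by simp
      then have "\<kappa> i = 0" using eq l by (simp add: \<kappa>_def)
      then show ?thesis
        using \<open>Suc i = l\<close> by (intro jacobi_trudi_zero_row[of i]) (auto simp: m_def partition_exponent_def)
    qed
  qed
  have "D (schur \<nu>) = sf_scale (- of_nat (card \<nu>)) (schur \<nu>) +
      (\<Sum>b\<in>corners \<nu>. sf_scale ((z + content b) * (z' + content b)) (schur (\<nu> - {b})))"
    using laguerre \<nu> unfolding is_laguerre_operator_def by blast
  also have "(\<Sum>b\<in>corners \<nu>. sf_scale ((z + content b) * (z' + content b)) (schur (\<nu> - {b})))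
     = (\<Sum>i\<in>?I. sf_scale (?c i) (from_h (?J i)))"
    unfolding corners_eq[OF \<nu> l, folded \<kappa>_def]
    by (rule sum.reindex_cong[of "\<lambda>i. (i, \<kappa> i - 1)"])
      (simp_all only: removed content add_diff_eq, simp add: inj_on_def)
  also have "\<dots> = (\<Sum>i<l. sf_scale (?c i) (from_h (?J i)))"
    using vanish by (intro sum.mono_neutral_left) (auto simp: sf_scale_def fun_eq_iff)
  also have "\<dots> = from_h (\<Sum>i<l. cpoly (?c i) * ?J i)"
    by (simp add: from_h_sum from_h_scale)
  also have "sf_scale (- of_nat (card \<nu>)) (schur \<nu>) + \<dots>
     = from_h (cpoly (- of_nat (card \<nu>)) * jacobi_trudi l m + (\<Sum>i<l. cpoly (?c i) * ?J i))"
    by (simp only: from_h_add from_h_scale schur)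
  also have "cpoly (- of_nat (card \<nu>)) * jacobi_trudi l m + (\<Sum>i<l. cpoly (?c i) * ?J i)
     = laguerre_diffop z z' (jacobi_trudi l m)"
  proof -
    have "(\<Sum>i<l. m i + int i) = int (card \<nu>)"
      by (simp add: card_young_diagram[OF \<nu> l] m_def \<kappa>_def partition_exponent_def)
    then show ?thesis
      by (simp add: laguerre_diffop_jacobi_trudi cpoly_minus cpoly_of_nat)
  qed
  finally show ?thesis
    by (simp add: intertwined_def schur m_def \<kappa>_def)
qed

text \<open>
  A determinant with two equal rows or a zero row vanishes.  Otherwise sorting the rows makes \<open>m\<close> strictly
  decreasing with last entry at least \<open>- l + 1\<close>, and then \<open>m i + i\<close> is a partition.
\<close>

lemma intertwined_jacobi_trudi: "intertwined (jacobi_trudi l m)"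
proof (cases "inj_on m {..<l} \<and> (\<forall>i<l. m i > - int l)")
  case False
  then consider i k where "i \<noteq> k" "i < l" "k < l" "m i = m k" | i where "i < l" "m i \<le> - int l"
    unfolding inj_on_def by (auto simp: not_less)
  then have "jacobi_trudi l m = 0"
    by cases (rule jacobi_trudi_equal_rows jacobi_trudi_zero_row; assumption)+
  then show ?thesis by (simp add: intertwined_0)
next
  case True
  then obtain \<pi> where \<pi>: "\<pi> permutes {0..<l}" and dec: "\<And>i j. i < j \<Longrightarrow> j < l \<Longrightarrow> m (\<pi> j) < m (\<pi> i)"
    using sorting_permutation[of m l] by blast
  define \<kappa> where "\<kappa> i = (if i < l then nat (m (\<pi> i) + int i) else 0)" for i
  have "0 \<le> m (\<pi> (l - Suc d)) + int (l - Suc d)" if "d < l" for d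
    using that
  proof (induction d)
    case 0
    then have "\<pi> (l - 1) < l" using permutes_in_image[OF \<pi>, of "l - 1"] by auto
    then have "m (\<pi> (l - 1)) > - int l" using True by blast
    then show ?case using 0 by (simp add: of_nat_diff)
  next
    case (Suc d)
    then have "l - Suc (Suc d) < l - Suc d" by linarith
    with Suc show ?case using dec[of "l - Suc (Suc d)" "l - Suc d"] by (simp add: of_nat_diff)
  qed
  note from_end = this
  have nonneg: "0 \<le> m (\<pi> i) + int i" if "i < l" for i
  proof -
    have "l - Suc (l - Suc i) = i" "l - Suc i < l" using that by linarith+
    then show ?thesis using from_end[of "l - Suc i"] by simp
  qed
  have "\<kappa> (Suc i) \<le> \<kappa> i" for i
    using dec[of i "Suc i"] by (auto simp: \<kappa>_def)
  moreover have zero: "\<forall>i\<ge>l. \<kappa> i = 0" by (simp add: \<kappa>_def)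
  ultimately have "intertwined (jacobi_trudi l (partition_exponent \<kappa>))"
    using diagram_of_row_lengths[of \<kappa> l] intertwined_young_diagram[of "{(i, j). j < \<kappa> i}" l] by simp
  also have "jacobi_trudi l (partition_exponent \<kappa>) = jacobi_trudi l (m \<circ> \<pi>)"
    using nonneg by (intro jacobi_trudi_cong) (simp add: partition_exponent_def \<kappa>_def)
  also have "\<dots> = signof \<pi> * jacobi_trudi l m"
    by (rule jacobi_trudi_permute[OF \<pi>])
  finally have "intertwined (signof \<pi> * (signof \<pi> * jacobi_trudi l m))"
    by (rule intertwined_signof)
  then show ?thesis
    by (simp add: sign_def split: if_splits)
qed

text \<open>
  The identity permutation contributes the product itself to a Jacobi--Trudi determinant.  The other
  permutations contribute products with smaller \<open>\<Sum>\<^sub>i i a\<^sub>i\<close>, or zero if some index is negative.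
\<close>

lemma intertwined_prod:
  fixes a :: "nat \<Rightarrow> int"
  shows "intertwined (\<Prod>i<l. h_int (a i))"
proof (induction "nat (\<Sum>i<l. int i * a i)" arbitrary: a rule: less_induct)
  case less
  show ?case
  proof (cases "\<forall>i<l. a i \<ge> 0")
    case False
    then obtain i where "i < l" "h_int (a i) = 0" by (auto simp: h_int_def not_le)
    then have "(\<Prod>i<l. h_int (a i)) = 0" by (intro prod_zero) auto
    then show ?thesis by (simp only: intertwined_0)
  next
    case True
    let ?b = "\<lambda>\<tau> k. a k - int k + int (\<tau> k)"
    have smaller: "intertwined (\<Prod>k<l. h_int (?b \<tau> k))" if "\<tau> \<in> perms l - {id}" for \<tau>
    proof (cases "\<forall>k<l. ?b \<tau> k \<ge> 0")
      case False
      then obtain k where "k < l" "h_int (?b \<tau> k) = 0" by (auto simp: h_int_def not_le)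
      then have "(\<Prod>k<l. h_int (?b \<tau> k)) = 0" by (intro prod_zero) auto
      then show ?thesis by (simp only: intertwined_0)
    next
      case nonneg: True
      have "(\<Sum>i<l. int i * ?b \<tau> i) = (\<Sum>i<l. int i * a i) + (\<Sum>i<l. int i * int (\<tau> i)) - (\<Sum>i<l. int i * int i)"
        by (simp add: algebra_simps sum.distrib sum_subtractf)
      also have "\<dots> < (\<Sum>i<l. int i * a i)"
        using sum_mult_permuted_less[of \<tau> l] that by (simp add: atLeast0LessThan)
      finally have "(\<Sum>i<l. int i * ?b \<tau> i) < (\<Sum>i<l. int i * a i)" .
      moreover have "0 \<le> (\<Sum>i<l. int i * ?b \<tau> i)"
        using nonneg by (intro sum_nonneg mult_nonneg_nonneg) auto
      ultimately show ?thesis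
        by (intro less) (simp add: nat_less_iff)
    qed
    have "jacobi_trudi l (\<lambda>k. a k - int k) = (\<Sum>\<tau>\<in>perms l. signof \<tau> * (\<Prod>k<l. h_int (?b \<tau> k)))"
      by (rule jacobi_trudi_eq_sum)
    also have "\<dots> = (\<Prod>k<l. h_int (a k)) + (\<Sum>\<tau>\<in>perms l - {id}. signof \<tau> * (\<Prod>k<l. h_int (?b \<tau> k)))"
      by (subst sum.remove[of _ id]) (auto simp: finite_permutations permutes_id sign_id)
    finally have "(\<Prod>k<l. h_int (a k)) = jacobi_trudi l (\<lambda>k. a k - int k)
        - (\<Sum>\<tau>\<in>perms l - {id}. signof \<tau> * (\<Prod>k<l. h_int (?b \<tau> k)))"
      by simp
    then show ?thesis
      using smaller by (auto intro!: intertwined_diff intertwined_jacobi_trudi intertwined_sum intertwined_signof)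
  qed
qed

lemma intertwined_all: "intertwined p"
proof (induction p rule: cmpoly_induct)
  case (monomial m c)
  define P where "P q \<longleftrightarrow> (\<exists>(l::nat) a. q = (\<Prod>i<l. h_int (a i)))" for q
  have "P 1" unfolding P_def by (intro exI[of _ 0]) auto
  have P_step: "P (q * vpoly i)" if q: "P q" for q i
  proof -
    obtain l :: nat and a where "q = (\<Prod>i<l. h_int (a i))" using q unfolding P_def by blast
    moreover have "(\<Prod>k<l. h_int ((a(l := int (Suc i))) k)) = (\<Prod>k<l. h_int (a k))"
      by (rule prod.cong) auto
    moreover have "h_int (int (Suc i)) = vpoly i"
      by (simp add: h_int_def hvar_def nat_add_distrib)
    ultimately have "q * vpoly i = (\<Prod>k<Suc l. h_int ((a(l := int (Suc i))) k))"
      by simp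
    then show ?thesis unfolding P_def by blast
  qed
  have P_power: "P (q * vpoly i ^ k)" if "P q" for q i k
    using that P_step by (induction k) (simp_all add: power_Suc2 mult.assoc[symmetric] del: power_Suc)
  have "P (\<Prod>i\<in>A. vpoly i ^ k i)" for A k
    using \<open>P 1\<close> P_power
    by (induction A rule: infinite_finite_induct) (simp_all add: mult.commute[of "vpoly _ ^ _"])
  then have "P (Poly_Mapping.single m 1)"
    by (simp only: monomial_as_prod)
  then have "intertwined (Poly_Mapping.single m 1)"
    unfolding P_def using intertwined_prod by auto
  moreover have "Poly_Mapping.single m c = cpoly c * Poly_Mapping.single m 1"
    by (simp add: cpoly_def mult_single)
  ultimately show ?case by (simp only: intertwined_scale)
qed (rule intertwined_add)

end

theorem corollary4p13:
  fixes z z' :: complex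
    and D :: "(nat \<Rightarrow> cmpoly) \<Rightarrow> nat \<Rightarrow> cmpoly"
  assumes "is_laguerre_operator z z' D"
  shows "\<forall>p. D (from_h p) = from_h (laguerre_diffop z z' p)"
proof -
  interpret laguerre z z' D using assms by unfold_locales
  show ?thesis using intertwined_all by (simp add: intertwined_def)
qed

end
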